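(* Consider the homogeneous transport equation with specular derivatives $$\partial^S_tu+\partial^S_xu=0,\qquad (x,t)\in\mathbb{R}\times(0,\infty).$$ Assume that a function $u:\mathbb{R}\times(0,\infty)\to\mathbb{R}$ has a strong specular tangent hyperplane at each point $(x,t)\in\mathbb{R}\times(0,\infty)$. Then the general solution of this equation is given by $$u(x,t)=h(x-t),$$ where $h$ is an arbitrary specularly differentiable function of a single variable.
   Context: Let $\Omega\subset\mathbb{R}^2$ be open (here $\Omega=\mathbb{R}\times(0,\infty)$ with variables $x_1=x$, $x_2=t$), $u:\Omega\to\mathbb{R}$, $a\in\Omega$, $e_i$ the $i$-th standard basis vector. One-sided limits: $u[a)_{(i)}=\lim_{h\searrow0}u(a+he_i)$, $u(a]_{(i)}=\lim_{h\nearrow0}u(a+he_i)$, and $u[a]_{(i)}=\frac12(u[a)_{(i)}+u(a]_{(i)})$; if $u[a]_{(1)}=u[a]_{(2)}$ the common value is $u[a]$. One-sided specular partial derivatives: $\partial^R_{x_i}u(a)=\lim_{h\searrow0}\frac{u(a+he_i)-u[a)_{(i)}}{h}$ and $\partial^L_{x_i}u(a)=\lim_{h\nearrow0}\frac{u(a+he_i)-u(a]_{(i)}}{h}$, as real numbers. Specular partial differentiability at $a$ with respect to $x_i$ means that both exist and $u[a)_{(i)}=u(a]_{(i)}$. With $\alpha_i=\partial^R_{x_i}u(a)$, $\beta_i=\partial^L_{x_i}u(a)$, the specular partial derivative is $$\partial^S_{x_i}u(a)=\begin{cases}\dfrac{\alpha_i\beta_i-1+\sqrt{(\alpha_i^2+1)(\beta_i^2+1)}}{\alpha_i+\beta_i}&\alpha_i+\beta_i\ne0,\\0&\alpha_i+\beta_i=0.\end{cases}$$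 For a function $h$ of a single real variable, specular differentiability is the same notion with one variable: at each point the one-sided limits of $h$ exist and coincide, and the right and left specular derivatives exist. Phototangent with respect to $x_i$: the graph over the line $a+\mathbb{R}e_i$ of the function equal, at $a+he_i$, to $\beta_ih+u(a]_{(i)}$ if $h<0$, $u[a]_{(i)}$ if $h=0$, and $\alpha_ih+u[a)_{(i)}$ if $h>0$. $\mathcal{P}(u,a)$ is the set of all intersection points in $\mathbb{R}^3$ of the phototangents of $u$ at $a$ (for those $i$ with respect to which $u$ is specularly partial differentiable) with the unit sphere centred at $(a,u[a]_{(i)})$. $u$ is specularly differentiable at $a$ if $|\mathcal{P}(u,a)|=4$ and $u[a]_{(1)}=u[a]_{(2)}$. A strong specular tangent hyperplane to the graph of $u$ at $(a,u[a])$ is a plane in $\mathbb{R}^3$ containing all four points of $\mathcal{P}(u,a)$, where $u$ is specularly differentiable at $a$; "$u$ has a strong specular tangent hyperplane at the point $a$" means it has one at $(a,u[a])$.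
   Formalization: As stated the claim fails (the indicator of one point solves the equation), so a solution is shown to satisfy u[(x,t)] = h(x-t) for its limit value u[(x,t)], and u(x,t) = h(x-t) itself when u(a) = u[a] at every point; every specularly differentiable h still gives a solution. *)

theory Defs
  imports "HOL-Analysis.Analysis"
begin

text \<open>
  One-sided limits and one-sided specular derivatives of f at a along a direction v.
  The i-th partial notions for a function on the plane are the case v = axis i 1; the
  notions for a function of one real variable are the case v = 1. None of them refers to
  the value f a itself. All are local, so for a function on an open set the values of its
  total extension outside that set are irrelevant.
\<close>

definition right_lim :: "('a::real_normed_vector \<Rightarrow> real) \<Rightarrow> 'a \<Rightarrow> 'a \<Rightarrow> real" where
  "right_lim f a v = Lim (at_right 0) (\<lambda>h. f (a + h *\<^sub>R v))"

definition left_lim :: "('a::real_normed_vector \<Rightarrow> real) \<Rightarrow> 'a \<Rightarrow> 'a \<Rightarrow> real" where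
  "left_lim f a v = Lim (at_left 0) (\<lambda>h. f (a + h *\<^sub>R v))"

definition mid_lim :: "('a::real_normed_vector \<Rightarrow> real) \<Rightarrow> 'a \<Rightarrow> 'a \<Rightarrow> real" where
  "mid_lim f a v = (right_lim f a v + left_lim f a v) / 2"

definition right_sderiv :: "('a::real_normed_vector \<Rightarrow> real) \<Rightarrow> 'a \<Rightarrow> 'a \<Rightarrow> real" where
  "right_sderiv f a v =
     Lim (at_right 0) (\<lambda>h. (f (a + h *\<^sub>R v) - right_lim f a v) / h)"

definition left_sderiv :: "('a::real_normed_vector \<Rightarrow> real) \<Rightarrow> 'a \<Rightarrow> 'a \<Rightarrow> real" where
  "left_sderiv f a v =
     Lim (at_left 0) (\<lambda>h. (f (a + h *\<^sub>R v) - left_lim f a v) / h)"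

definition sdifferentiable_along ::
    "('a::real_normed_vector \<Rightarrow> real) \<Rightarrow> 'a \<Rightarrow> 'a \<Rightarrow> bool" where
  "sdifferentiable_along f a v \<longleftrightarrow>
     (\<exists>l. ((\<lambda>h. f (a + h *\<^sub>R v)) \<longlongrightarrow> l) (at_right 0)) \<and>
     (\<exists>l. ((\<lambda>h. f (a + h *\<^sub>R v)) \<longlongrightarrow> l) (at_left 0)) \<and>
     right_lim f a v = left_lim f a v \<and>
     (\<exists>d. ((\<lambda>h. (f (a + h *\<^sub>R v) - right_lim f a v) / h) \<longlongrightarrow> d) (at_right 0)) \<and>
     (\<exists>d. ((\<lambda>h. (f (a + h *\<^sub>R v) - left_lim f a v) / h) \<longlongrightarrow> d) (at_left 0))"

definition sderiv_along :: "('a::real_normed_vector \<Rightarrow> real) \<Rightarrow> 'a \<Rightarrow> 'a \<Rightarrow> real" where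
  "sderiv_along f a v =
     (let \<alpha> = right_sderiv f a v; \<beta> = left_sderiv f a v in
      if \<alpha> + \<beta> \<noteq> 0
      then (\<alpha> * \<beta> - 1 + sqrt ((\<alpha>\<^sup>2 + 1) * (\<beta>\<^sup>2 + 1))) / (\<alpha> + \<beta>)
      else 0)"

definition sdifferentiable_real :: "(real \<Rightarrow> real) \<Rightarrow> bool" where
  "sdifferentiable_real h \<longleftrightarrow> (\<forall>s. sdifferentiable_along h s 1)"

abbreviation sdifferentiable_partial :: "(real^2 \<Rightarrow> real) \<Rightarrow> real^2 \<Rightarrow> 2 \<Rightarrow> bool" where
  "sdifferentiable_partial u a i \<equiv> sdifferentiable_along u a (axis i 1)"

abbreviation spartial :: "2 \<Rightarrow> (real^2 \<Rightarrow> real) \<Rightarrow> real^2 \<Rightarrow> real" where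
  "spartial i u a \<equiv> sderiv_along u a (axis i 1)"

text \<open>
  Three-dimensional space is represented as \<^typ>\<open>(real^2) \<times> real\<close>, whose product norm is
  the Euclidean one.
\<close>

definition phototangent :: "(real^2 \<Rightarrow> real) \<Rightarrow> real^2 \<Rightarrow> 2 \<Rightarrow> ((real^2) \<times> real) set" where
  "phototangent u a i =
     range (\<lambda>h. (a + h *\<^sub>R axis i 1,
       if h < 0 then left_sderiv u a (axis i 1) * h + left_lim u a (axis i 1)
       else if h = 0 then mid_lim u a (axis i 1)
       else right_sderiv u a (axis i 1) * h + right_lim u a (axis i 1)))"

definition photo_points :: "(real^2 \<Rightarrow> real) \<Rightarrow> real^2 \<Rightarrow> ((real^2) \<times> real) set" where
  "photo_points u a =
     (\<Union>i\<in>{i. sdifferentiable_partial u a i}.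
        phototangent u a i \<inter> sphere (a, mid_lim u a (axis i 1)) 1)"

definition sdifferentiable_at :: "(real^2 \<Rightarrow> real) \<Rightarrow> real^2 \<Rightarrow> bool" where
  "sdifferentiable_at u a \<longleftrightarrow>
     card (photo_points u a) = 4 \<and> mid_lim u a (axis 1 1) = mid_lim u a (axis 2 1)"

text \<open>
  The common value u[a] of the two midpoints; meaningful only where they agree. It may differ
  from u a: specular differentiability admits removable discontinuities.
\<close>

definition specular_value :: "(real^2 \<Rightarrow> real) \<Rightarrow> real^2 \<Rightarrow> real" where
  "specular_value u a = (THE c. \<forall>i. mid_lim u a (axis i 1) = c)"

definition strong_specular_tangent_hyperplane ::
    "(real^2 \<Rightarrow> real) \<Rightarrow> real^2 \<Rightarrow> ((real^2) \<times> real) set \<Rightarrow> bool" where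
  "strong_specular_tangent_hyperplane u a S \<longleftrightarrow>
     sdifferentiable_at u a \<and> affine S \<and> aff_dim S = 2 \<and> photo_points u a \<subseteq> S"

text \<open>Component 1 is the space variable x, component 2 is the time variable t.\<close>

definition upper_half_plane :: "(real^2) set" where
  "upper_half_plane = {a. a $ 2 > 0}"

definition has_strong_hyperplanes :: "(real^2 \<Rightarrow> real) \<Rightarrow> bool" where
  "has_strong_hyperplanes u \<longleftrightarrow>
     (\<forall>a\<in>upper_half_plane. \<exists>S. strong_specular_tangent_hyperplane u a S)"

definition solves_transport :: "(real^2 \<Rightarrow> real) \<Rightarrow> bool" where
  "solves_transport u \<longleftrightarrow>
     (\<forall>a\<in>upper_half_plane.
        sdifferentiable_partial u a 1 \<and> sdifferentiable_partial u a 2 \<and>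
        spartial 2 u a + spartial 1 u a = 0)"

end

theory Submission
  imports Defs
begin

text \<open>
  Write U for the specular value of u. Along each coordinate line U is continuous, with the same
  one-sided slopes as u. In the direction of an axis, the two half-tangents meet the unit sphere
  in two points of a chord whose slope is the specular derivative; if the four points are coplanar
  and the two specular derivatives are opposite, then the chords are mirror images of each other,
  so the right slope of U in t is minus its left slope in x, and vice versa.

  It remains to show that these relations alone, without joint continuity, make U constant on the
  lines x - t = const. Call a point singular if U is not constant along these lines near it. By
  the Baire category theorem, if there are singular points, then there is a square around one of
  them in which the difference quotients of U along the axes, taken at singular points, are
  uniformly bounded. This makes U Lipschitz along the characteristics in the square. There
  V(y) = \<integral> U(x + y, y) dx over a fixed interval has derivative 0: regular points contribute nothing,
  and at singular points the increment along the characteristic splits into a horizontal and a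
  vertical one, where a translation of the integration variable moves the latter to the original
  point; the slopes cancel because left and right slopes agree off a countable set. So V is
  constant for every interval, hence U is constant along the characteristics in the square,
  a contradiction.
\<close>

subsection \<open>Functions of one real variable\<close>

lemma integrable_indicator_times:
  fixes f :: "real \<Rightarrow> real"
  assumes "f \<in> borel_measurable borel" "compact F" "\<And>x. x \<in> F \<Longrightarrow> \<bar>f x\<bar> \<le> N"
  shows "integrable lborel (\<lambda>x. indicator F x * f x)"
proof (rule Bochner_Integration.integrable_bound)
  show "integrable lborel (\<lambda>x. N * indicator F x)"
    using emeasure_compact_finite[OF assms(2)] borel_compact[OF assms(2)]
    by (intro integrable_mult_right) (simp add: less_top[symmetric])
  show "(\<lambda>x. indicator F x * f x) \<in> borel_measurable lborel"
    using assms(1) borel_compact[OF assms(2)] by measurable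
  show "AE x in lborel. norm (indicator F x * f x) \<le> norm (N * indicator F x)"
    using assms(3) by (intro AE_I2) (auto simp: indicator_def intro: order_trans[OF _ abs_ge_self])
qed

lemma integral_translate:
  fixes f :: "real \<Rightarrow> real"
  shows "(\<integral>x. f (x + k) \<partial>lborel) = (\<integral>x. f x \<partial>lborel)"
  using lborel_integral_real_affine[of 1 f k] by (simp add: add.commute)

text \<open>\<open>F\<close> and its translate have equal measure, so the part of \<open>F\<close>
  outside the translate is as large as the part of the translate outside \<open>F\<close>. The
  indicator of the latter tends to 0 pointwise because the complement of \<open>F\<close> is open,
  and dominated convergence applies.\<close>

lemma compact_minus_translate_tendsto_0:
  fixes F :: "real set" and k :: "nat \<Rightarrow> real"
  assumes F: "compact F" and k: "k \<longlonglongrightarrow> 0"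
  shows "(\<lambda>n. \<integral>x. indicator F x * (1 - indicator F (x + k n)) \<partial>lborel) \<longlonglongrightarrow> (0::real)"
proof -
  let ?F = "indicator F :: real \<Rightarrow> real"
  have [measurable]: "F \<in> sets borel" by (rule borel_compact[OF F])
  obtain B where B: "\<And>x. x \<in> F \<Longrightarrow> \<bar>x\<bar> \<le> B"
    using compact_imp_bounded[OF F] unfolding bounded_iff by auto
  obtain K where K: "\<And>n. \<bar>k n\<bar> \<le> K"
    using convergent_imp_Bseq[OF convergentI[OF k]] unfolding Bseq_def by auto
  have iF: "integrable lborel (\<lambda>x. ?F x)"
    using integrable_indicator_times[of "\<lambda>_. 1" F 1] F by simp
  have iFk: "integrable lborel (\<lambda>x. ?F (x + k n))" for n
    using lborel_integrable_real_affine[OF iF, of 1 "k n"] by (simp add: add.commute)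
  have iFF: "integrable lborel (\<lambda>x. ?F x * ?F (x + k n))" for n
    by (rule integrable_indicator_times[where N = 1]) (auto simp: F indicator_def)
  have "(\<integral>x. ?F x * (1 - ?F (x + k n)) \<partial>lborel) =
      (\<integral>x. ?F (x + k n) * (1 - ?F x) \<partial>lborel)" for n
  proof -
    have "(\<integral>x. ?F x * (1 - ?F (x + k n)) \<partial>lborel) =
       (\<integral>x. ?F x \<partial>lborel) - (\<integral>x. ?F x * ?F (x + k n) \<partial>lborel)"
      unfolding right_diff_distrib mult_1_right by (intro Bochner_Integration.integral_diff iF iFF)
    also have "\<dots> = (\<integral>x. ?F (x + k n) \<partial>lborel) - (\<integral>x. ?F (x + k n) * ?F x \<partial>lborel)"
      unfolding integral_translate[of ?F] by (simp add: mult.commute)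
    also have "\<dots> = (\<integral>x. ?F (x + k n) * (1 - ?F x) \<partial>lborel)"
      unfolding right_diff_distrib mult_1_right
      using iFF by (intro Bochner_Integration.integral_diff[symmetric] iFk) (simp add: mult.commute)
    finally show ?thesis .
  qed
  moreover have "(\<lambda>n. \<integral>x. ?F (x + k n) * (1 - ?F x) \<partial>lborel)
      \<longlonglongrightarrow> (\<integral>x. 0 \<partial>(lborel :: real measure))"
  proof (rule integral_dominated_convergence[where w = "indicator {- (B + K)..B + K}"])
    show "AE x in lborel. (\<lambda>n. ?F (x + k n) * (1 - ?F x)) \<longlonglongrightarrow> 0"
    proof (intro AE_I2)
      fix x
      show "(\<lambda>n. ?F (x + k n) * (1 - ?F x)) \<longlonglongrightarrow> 0"
      proof (cases "x \<in> F")
        case False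
        have "(\<lambda>n. x + k n) \<longlonglongrightarrow> x" using tendsto_add[OF tendsto_const k, of x] by simp
        then have "\<forall>\<^sub>F n in sequentially. x + k n \<in> - F"
          by (rule topological_tendstoD) (use False compact_imp_closed[OF F] in auto)
        then show ?thesis
          by (intro tendsto_eventually) (auto elim!: eventually_mono)
      qed simp
    qed
    have "norm (?F (x + k n) * (1 - ?F x)) \<le> indicator {- (B + K)..B + K} x" for n x
      using B[of "x + k n"] K[of n] by (auto simp: indicator_def abs_le_iff)
    then show "AE x in lborel. norm (?F (x + k n) * (1 - ?F x))
        \<le> indicator {- (B + K)..B + K} x" for n
      by simp
    show "integrable lborel (indicator {- (B + K)..B + K} :: real \<Rightarrow> real)"
      using integrable_indicator_times[of "\<lambda>_. 1" "{- (B + K)..B + K}" 1] by simp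
  qed auto
  ultimately show ?thesis by simp
qed

text \<open>In the application \<open>D n\<close> is a difference quotient along the characteristic,
  and \<open>f n\<close> and \<open>g n\<close> are the vertical and the horizontal one. The
  splitting \<open>D_eq\<close> evaluates \<open>f n\<close> at the moving point
  \<open>x + k n\<close>, where no pointwise limit is known; translating the integration variable
  brings it back to \<open>x\<close>. The points of \<open>F\<close> that leave \<open>F\<close>
  under the shift have measure tending to 0, and off \<open>F\<close> the limit is given by
  \<open>lim_D\<close>.\<close>

lemma integral_tendsto_0_by_translation:
  fixes f g D :: "nat \<Rightarrow> real \<Rightarrow> real"
  assumes F: "compact F" "F \<subseteq> {A..B}" and k: "k \<longlonglongrightarrow> 0" and C: "countable C"
    and cont: "\<And>n. continuous_on F (f n)" "\<And>n. continuous_on F (g n)" "\<And>n. continuous_on {A..B} (D n)"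
    and f: "\<And>n x. x \<in> F \<Longrightarrow> \<bar>f n x\<bar> \<le> N" and g: "\<And>n x. x \<in> F \<Longrightarrow> \<bar>g n x\<bar> \<le> N"
    and D: "\<And>n x. x \<in> {A..B} \<Longrightarrow> \<bar>D n x\<bar> \<le> M"
    and lim_fg: "\<And>x. x \<in> F - C \<Longrightarrow> (\<lambda>n. f n x + g n x) \<longlonglongrightarrow> 0"
    and lim_D: "\<And>x. x \<in> {A..B} - F \<Longrightarrow> (\<lambda>n. D n x) \<longlonglongrightarrow> 0"
    and D_eq: "\<And>n x. x \<in> F \<Longrightarrow> x + k n \<in> F \<Longrightarrow> D n x = f n (x + k n) + g n x"
  shows "(\<lambda>n. \<integral>x. indicator {A..B} x * D n x \<partial>lborel) \<longlonglongrightarrow> 0"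
proof -
  let ?F = "indicator F :: real \<Rightarrow> real"
  have [measurable]: "F \<in> sets borel" by (rule borel_compact[OF F(1)])
  \<comment> \<open>Extension by zero makes the three functions Borel measurable on the whole
    line.\<close>
  define f' g' D' where "f' n x = ?F x * f n x" and "g' n x = ?F x * g n x"
    and "D' n x = indicator {A..B} x * D n x" for n x
  have [measurable]: "f' n \<in> borel_measurable borel" "g' n \<in> borel_measurable borel"
      "D' n \<in> borel_measurable borel" for n
    using borel_measurable_continuous_on_indicator[OF _ cont(1)[of n]]
      borel_measurable_continuous_on_indicator[OF _ cont(2)[of n]]
      borel_measurable_continuous_on_indicator[OF _ cont(3)[of n]]
    by (auto simp: f'_def[abs_def] g'_def[abs_def] D'_def[abs_def])
  have bnd: "\<bar>f' n x\<bar> \<le> N" "\<bar>g' n x\<bar> \<le> N" "\<bar>D' n x\<bar> \<le> M" if "x \<in> F" for n x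
    using f[OF that] g[OF that] D[of x n] that F(2) by (auto simp: f'_def g'_def D'_def)
  have F_mult: "?F x * f' n x = f' n x" "?F x * g' n x = g' n x" for n x
    by (auto simp: f'_def g'_def indicator_def)
  have F_compl: "\<bar>1 - ?F y\<bar> \<le> 1" "\<bar>?F y\<bar> \<le> 1" for y by (auto simp: indicator_def)
  have int: "integrable lborel (\<lambda>x. ?F x * (h x * u x))"
    if "h \<in> borel_measurable borel" "u \<in> borel_measurable borel" "\<And>x. \<bar>h x\<bar> \<le> 1"
      "\<And>x. x \<in> F \<Longrightarrow> \<bar>u x\<bar> \<le> L" for h u L
  proof (rule integrable_indicator_times[where N = L])
    show "(\<lambda>x. h x * u x) \<in> borel_measurable borel" using that by measurable
    show "\<bar>h x * u x\<bar> \<le> L" if "x \<in> F" for x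
      using mult_mono[OF \<open>\<And>x. \<bar>h x\<bar> \<le> 1\<close> \<open>\<And>x. x \<in> F \<Longrightarrow> \<bar>u x\<bar> \<le> L\<close>, of x x] that by (simp add: abs_mult)
  qed (rule F(1))
  \<comment> \<open>Error terms: a bounded integrand over the points of \<open>F\<close> that the
    shift \<open>c n\<close> moves out of \<open>F\<close>.\<close>
  have small: "(\<lambda>n. \<integral>x. ?F x * ((1 - ?F (x + c n)) * u n x) \<partial>lborel) \<longlonglongrightarrow> 0"
    if u: "\<And>n. u n \<in> borel_measurable borel" "\<And>n x. x \<in> F \<Longrightarrow> \<bar>u n x\<bar> \<le> L" and c: "c \<longlonglongrightarrow> 0"
    for u :: "nat \<Rightarrow> real \<Rightarrow> real" and L c
  proof (rule Lim_null_comparison)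
    have "norm (\<integral>x. ?F x * ((1 - ?F (x + c n)) * u n x) \<partial>lborel)
        \<le> (\<integral>x. L * (?F x * (1 - ?F (x + c n))) \<partial>lborel)" for n
    proof (rule Bochner_Integration.integral_norm_bound_integral)
      show "integrable lborel (\<lambda>x. ?F x * ((1 - ?F (x + c n)) * u n x))"
        by (rule int[where L = L]) (use u F_compl in \<open>auto intro!: borel_measurable_diff\<close>)
      show "integrable lborel (\<lambda>x. L * (?F x * (1 - ?F (x + c n))))"
        using int[of "\<lambda>x. 1 - ?F (x + c n)" "\<lambda>_. 1" 1] F_compl
        by (intro integrable_mult_right) simp
      show "norm (?F x * ((1 - ?F (x + c n)) * u n x)) \<le> L * (?F x * (1 - ?F (x + c n)))" for x
        using u(2)[of x n] by (auto simp: indicator_def)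
    qed
    then show "\<forall>\<^sub>F n in sequentially. norm (\<integral>x. ?F x * ((1 - ?F (x + c n)) * u n x) \<partial>lborel)
        \<le> L * (\<integral>x. (?F x * (1 - ?F (x + c n))) \<partial>lborel)"
      by simp
    show "(\<lambda>n. L * (\<integral>x. (?F x * (1 - ?F (x + c n))) \<partial>lborel)) \<longlonglongrightarrow> 0"
      using tendsto_mult_left[OF compact_minus_translate_tendsto_0[OF F(1) c], of L] by simp
  qed
  have k': "(\<lambda>n. - k n) \<longlonglongrightarrow> 0" using tendsto_minus[OF k] by simp
  have fg: "(\<lambda>n. \<integral>x. f' n x + g' n x \<partial>lborel) \<longlonglongrightarrow> (\<integral>x. 0 \<partial>(lborel :: real measure))"
  proof (rule integral_dominated_convergence[where w = "\<lambda>x. ?F x * (1 * (2 * N))"])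
    have "AE x in lborel. x \<notin> C"
      using C by (intro AE_not_in countable_imp_null_set_lborel)
    then show "AE x in lborel. (\<lambda>n. f' n x + g' n x) \<longlonglongrightarrow> 0"
    proof (rule AE_mp, intro AE_I2 impI)
      fix x assume "x \<notin> C"
      then show "(\<lambda>n. f' n x + g' n x) \<longlonglongrightarrow> 0"
        using lim_fg[of x] by (cases "x \<in> F") (auto simp: f'_def g'_def)
    qed
    show "integrable lborel (\<lambda>x. ?F x * (1 * (2 * N)))"
      by (rule int[where L = "\<bar>2 * N\<bar>"]) auto
    have "norm (f' n x + g' n x) \<le> ?F x * (1 * (2 * N))" for n x
      using f[of x n] g[of x n] by (cases "x \<in> F") (auto simp: f'_def g'_def)
    then show "AE x in lborel. norm (f' n x + g' n x) \<le> ?F x * (1 * (2 * N))" for n by simp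
  qed auto
  have on_F: "(\<lambda>n. \<integral>x. ?F x * (?F (x + k n) * D' n x) \<partial>lborel) \<longlonglongrightarrow> 0"
  proof -
    have "(\<integral>x. ?F x * (?F (x + k n) * D' n x) \<partial>lborel) =
       (\<integral>x. f' n x + g' n x \<partial>lborel) - (\<integral>x. ?F x * ((1 - ?F (x + - k n)) * f' n x) \<partial>lborel)
        - (\<integral>x. ?F x * ((1 - ?F (x + k n)) * g' n x) \<partial>lborel)" for n
    proof -
      have i1: "integrable lborel (\<lambda>x. ?F x * (?F (x + - k n) * f' n x))"
        by (rule int[where L = N]) (use bnd F_compl in auto)
      have i2: "integrable lborel (\<lambda>x. ?F x * (?F (x + k n) * g' n x))"
        by (rule int[where L = N]) (use bnd F_compl in auto)
      have i3: "integrable lborel (\<lambda>x. ?F x * (1 * f' n x))" "integrable lborel (\<lambda>x. ?F x * (1 * g' n x))"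
        by (rule int[where L = N]; use bnd F_compl in auto)+
      \<comment> \<open>Shifted by \<open>k n\<close>, \<open>\<phi>\<close> is the \<open>f\<close>
        part of \<open>D' n\<close> on the points where both \<open>x\<close> and
        \<open>x + k n\<close> lie in \<open>F\<close>; translation invariance then removes the
        shift.\<close>
      define \<phi> where "\<phi> x = ?F x * (?F (x + - k n) * f' n x)" for x
      have "integrable lborel (\<lambda>x. \<phi> (x + k n))"
        using lborel_integrable_real_affine[OF i1, of 1 "k n"] by (simp add: add.commute \<phi>_def)
      have "(\<integral>x. ?F x * (?F (x + k n) * D' n x) \<partial>lborel) =
         (\<integral>x. \<phi> (x + k n) + ?F x * (?F (x + k n) * g' n x) \<partial>lborel)"
      proof (rule Bochner_Integration.integral_cong[OF refl])
        fix x
        show "?F x * (?F (x + k n) * D' n x) = \<phi> (x + k n) + ?F x * (?F (x + k n) * g' n x)"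
          using D_eq[of x n] F(2) by (auto simp: indicator_def \<phi>_def f'_def g'_def D'_def)
      qed
      also have "\<dots> = (\<integral>x. \<phi> (x + k n) \<partial>lborel) + (\<integral>x. ?F x * (?F (x + k n) * g' n x) \<partial>lborel)"
        by (intro Bochner_Integration.integral_add i2) fact
      also have "(\<integral>x. \<phi> (x + k n) \<partial>lborel) = (\<integral>x. \<phi> x \<partial>lborel)"
        by (rule integral_translate)
      also have "(\<integral>x. \<phi> x \<partial>lborel) = (\<integral>x. ?F x * (1 * f' n x) \<partial>lborel)
          - (\<integral>x. ?F x * ((1 - ?F (x + - k n)) * f' n x) \<partial>lborel)"
        using Bochner_Integration.integral_diff[OF i3(1) i1] by (simp add: \<phi>_def algebra_simps)
      also have "(\<integral>x. ?F x * (?F (x + k n) * g' n x) \<partial>lborel) = (\<integral>x. ?F x * (1 * g' n x) \<partial>lborel)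
          - (\<integral>x. ?F x * ((1 - ?F (x + k n)) * g' n x) \<partial>lborel)"
        using Bochner_Integration.integral_diff[OF i3(2) i2] by (simp add: algebra_simps)
      finally show ?thesis
        using Bochner_Integration.integral_add[OF i3] by (simp add: F_mult)
    qed
    moreover have "(\<lambda>n. (\<integral>x. f' n x + g' n x \<partial>lborel) - (\<integral>x. ?F x * ((1 - ?F (x + - k n)) * f' n x) \<partial>lborel)
        - (\<integral>x. ?F x * ((1 - ?F (x + k n)) * g' n x) \<partial>lborel)) \<longlonglongrightarrow> 0 - 0 - 0"
      using fg by (intro tendsto_diff small[where L = N] k k' bnd) auto
    ultimately show ?thesis by simp
  qed
  have off_F: "(\<lambda>n. \<integral>x. indicator ({A..B} - F) x * D n x \<partial>lborel) \<longlonglongrightarrow> (\<integral>x. 0 \<partial>(lborel :: real measure))"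
  proof (rule integral_dominated_convergence[where w = "\<lambda>x. indicator {A..B} x * M"])
    have eq: "indicator ({A..B} - F) x * D n x = (1 - ?F x) * D' n x" for n x
      by (auto simp: indicator_def D'_def)
    show "(\<lambda>x. indicator ({A..B} - F) x * D n x) \<in> borel_measurable lborel" for n
      unfolding eq by measurable
    show "AE x in lborel. (\<lambda>n. indicator ({A..B} - F) x * D n x) \<longlonglongrightarrow> 0"
    proof (intro AE_I2)
      show "(\<lambda>n. indicator ({A..B} - F) x * D n x) \<longlonglongrightarrow> 0" for x
        using lim_D[of x] by (cases "x \<in> {A..B} - F") auto
    qed
    show "integrable lborel (\<lambda>x. indicator {A..B} x * M)"
      by (rule integrable_indicator_times[where N = "\<bar>M\<bar>"]) auto
    have "norm (indicator ({A..B} - F) x * D n x) \<le> indicator {A..B} x * M" for n x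
      using D[of x n] by (cases "x \<in> {A..B}"; cases "x \<in> F") auto
    then show "AE x in lborel. norm (indicator ({A..B} - F) x * D n x) \<le> indicator {A..B} x * M" for n
      by simp
  qed auto
  \<comment> \<open>Three parts: off \<open>F\<close>, in \<open>F\<close> but moved out of it, in
    \<open>F\<close> and kept in it.\<close>
  have "(\<integral>x. indicator {A..B} x * D n x \<partial>lborel) = (\<integral>x. indicator ({A..B} - F) x * D n x \<partial>lborel)
      + (\<integral>x. ?F x * ((1 - ?F (x + k n)) * D' n x) \<partial>lborel)
      + (\<integral>x. ?F x * (?F (x + k n) * D' n x) \<partial>lborel)" for n
  proof -
    have i1: "integrable lborel (\<lambda>x. ?F x * ((1 - ?F (x + k n)) * D' n x))"
      by (rule int[where L = M]) (use bnd F_compl in \<open>auto intro!: borel_measurable_diff\<close>)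
    have i2: "integrable lborel (\<lambda>x. ?F x * (?F (x + k n) * D' n x))"
      by (rule int[where L = M]) (use bnd F_compl in auto)
    have i3: "integrable lborel (\<lambda>x. indicator {A..B} x * ((1 - ?F x) * D' n x))"
    proof (rule integrable_indicator_times[where N = M])
      show "\<bar>(1 - ?F x) * D' n x\<bar> \<le> M" if "x \<in> {A..B}" for x
        using D[OF that, of n] that by (auto simp: indicator_def D'_def)
    qed auto
    have "(\<lambda>x. indicator {A..B} x * D n x) = (\<lambda>x. indicator {A..B} x * ((1 - ?F x) * D' n x)
        + ?F x * ((1 - ?F (x + k n)) * D' n x) + ?F x * (?F (x + k n) * D' n x))"
      using F(2) by (auto simp: indicator_def D'_def)
    moreover have "indicator ({A..B} - F) x * D n x = indicator {A..B} x * ((1 - ?F x) * D' n x)" for x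
      by (auto simp: indicator_def D'_def)
    ultimately show ?thesis
      using i1 i2 i3 by simp
  qed
  moreover have "(\<lambda>n. (\<integral>x. indicator ({A..B} - F) x * D n x \<partial>lborel)
      + (\<integral>x. ?F x * ((1 - ?F (x + k n)) * D' n x) \<partial>lborel)
      + (\<integral>x. ?F x * (?F (x + k n) * D' n x) \<partial>lborel)) \<longlonglongrightarrow> 0 + 0 + 0"
    using off_F by (intro tendsto_add on_F small[where L = M] k bnd) auto
  ultimately show ?thesis by simp
qed

section \<open>Countability of the corners of a function with one-sided derivatives\<close>

text \<open>A rational interval around each such point singles it out: two points sharing an
  interval would each lie strictly below the other. So the points inject into pairs of
  rationals.\<close>

lemma countable_strict_local_min:
  fixes f :: "real \<Rightarrow> real"
  assumes "\<And>x. x \<in> S \<Longrightarrow> \<exists>d>0. \<forall>y. 0 < \<bar>y - x\<bar> \<and> \<bar>y - x\<bar> < d \<longrightarrow> f x < f y"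
  shows "countable S"
proof -
  have "\<exists>p q. p \<in> \<rat> \<and> q \<in> \<rat> \<and> p < x \<and> x < q \<and> (\<forall>y. p < y \<and> y < q \<and> y \<noteq> x \<longrightarrow> f x < f y)"
    if x: "x \<in> S" for x
  proof -
    obtain d where d: "d > 0" "\<And>y. 0 < \<bar>y - x\<bar> \<Longrightarrow> \<bar>y - x\<bar> < d \<Longrightarrow> f x < f y"
      using assms[OF x] by blast
    obtain p where p: "p \<in> \<rat>" "x - d < p" "p < x"
      using Rats_dense_in_real[of "x - d" x] d(1) by auto
    obtain q where q: "q \<in> \<rat>" "x < q" "q < x + d"
      using Rats_dense_in_real[of x "x + d"] d(1) by auto
    have "f x < f y" if "p < y \<and> y < q \<and> y \<noteq> x" for y
      by (rule d(2)) (use that p q in auto)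
    then show ?thesis using p q by blast
  qed
  then obtain P Q where PQ: "\<And>x. x \<in> S \<Longrightarrow> P x \<in> \<rat> \<and> Q x \<in> \<rat> \<and> P x < x \<and> x < Q x \<and>
      (\<forall>y. P x < y \<and> y < Q x \<and> y \<noteq> x \<longrightarrow> f x < f y)"
    by metis
  have "inj_on (\<lambda>x. (P x, Q x)) S"
  proof (rule inj_onI, rule ccontr)
    fix x y assume xy: "x \<in> S" "y \<in> S" "(P x, Q x) = (P y, Q y)" "x \<noteq> y"
    then have "f x < f y" "f y < f x"
      using PQ[OF xy(1)] PQ[OF xy(2)] by auto
    then show False by simp
  qed
  moreover have "countable ((\<lambda>x. (P x, Q x)) ` S)"
    by (rule countable_subset[of _ "\<rat> \<times> \<rat>"]) (use PQ countable_rat in auto)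
  ultimately show ?thesis
    by (rule countable_image_inj_on[rotated])
qed

text \<open>For a rational \<open>q\<close> strictly between the one-sided derivatives, subtracting
  the line of slope \<open>q\<close> turns the corner into a strict local minimum.\<close>

lemma countable_corners_aux:
  fixes f :: "real \<Rightarrow> real"
  assumes r: "\<And>x. x \<in> S \<Longrightarrow> ((\<lambda>h. (f (x + h) - f x) / h) \<longlongrightarrow> a x) (at_right 0)"
    and l: "\<And>x. x \<in> S \<Longrightarrow> ((\<lambda>h. (f (x + h) - f x) / h) \<longlongrightarrow> b x) (at_left 0)"
  shows "countable {x \<in> S. b x < a x}"
proof -
  have "countable {x \<in> S. b x < q \<and> q < a x}" for q
  proof (rule countable_strict_local_min[where f = "\<lambda>y. f y - q * y"])
    fix x assume x: "x \<in> {x \<in> S. b x < q \<and> q < a x}"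
    have "\<forall>\<^sub>F h in at_right 0. q < (f (x + h) - f x) / h"
      by (rule order_tendstoD(1)[OF r]) (use x in auto)
    then obtain d1 where d1: "d1 > 0" "\<And>h. 0 < h \<Longrightarrow> h < d1 \<Longrightarrow> q < (f (x + h) - f x) / h"
      unfolding eventually_at_right_field by auto
    have "\<forall>\<^sub>F h in at_left 0. (f (x + h) - f x) / h < q"
      by (rule order_tendstoD(2)[OF l]) (use x in auto)
    then obtain d2 where d2: "d2 < 0" "\<And>h. d2 < h \<Longrightarrow> h < 0 \<Longrightarrow> (f (x + h) - f x) / h < q"
      unfolding eventually_at_left_field by auto
    have "f x - q * x < f y - q * y" if "0 < \<bar>y - x\<bar> \<and> \<bar>y - x\<bar> < min d1 (- d2)" for y
    proof (cases "x < y")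
      case True
      then have "q < (f (x + (y - x)) - f x) / (y - x)"
        by (intro d1) (use that in auto)
      then show ?thesis using True by (simp add: field_simps)
    next
      case False
      then have "(f (x + (y - x)) - f x) / (y - x) < q"
        by (intro d2) (use that in auto)
      moreover have "y - x < 0" using False that by auto
      ultimately show ?thesis by (simp add: field_simps)
    qed
    then show "\<exists>d>0. \<forall>y. 0 < \<bar>y - x\<bar> \<and> \<bar>y - x\<bar> < d \<longrightarrow> f x - q * x < f y - q * y"
      using d1(1) d2(1) by (intro exI[of _ "min d1 (- d2)"]) auto
  qed
  then have "countable (\<Union>q\<in>\<rat>. {x \<in> S. b x < q \<and> q < a x})"
    using countable_rat by blast
  moreover have "{x \<in> S. b x < a x} \<subseteq> (\<Union>q\<in>\<rat>. {x \<in> S. b x < q \<and> q < a x})"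
    using Rats_dense_in_real by fastforce
  ultimately show ?thesis
    by (rule countable_subset[rotated])
qed

lemma countable_corners:
  fixes f :: "real \<Rightarrow> real"
  assumes r: "\<And>x. x \<in> S \<Longrightarrow> ((\<lambda>h. (f (x + h) - f x) / h) \<longlongrightarrow> a x) (at_right 0)"
    and l: "\<And>x. x \<in> S \<Longrightarrow> ((\<lambda>h. (f (x + h) - f x) / h) \<longlongrightarrow> b x) (at_left 0)"
  shows "countable {x \<in> S. a x \<noteq> b x}"
proof -
  have "countable {x \<in> S. b x < a x}"
    by (rule countable_corners_aux[OF r l])
  moreover have "countable {x \<in> S. - b x < - a x}"
  proof (rule countable_corners_aux[where f = "\<lambda>x. - f x"])
    show "((\<lambda>h. (- f (x + h) - - f x) / h) \<longlongrightarrow> - a x) (at_right 0)" if "x \<in> S" for x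
      using tendsto_minus[OF r[OF that]] by (simp add: minus_divide_left)
    show "((\<lambda>h. (- f (x + h) - - f x) / h) \<longlongrightarrow> - b x) (at_left 0)" if "x \<in> S" for x
      using tendsto_minus[OF l[OF that]] by (simp add: minus_divide_left)
  qed
  ultimately have "countable ({x \<in> S. b x < a x} \<union> {x \<in> S. - b x < - a x})"
    by simp
  then show ?thesis
    by (rule countable_subset[rotated]) auto
qed

section \<open>Consequences of convergent one-sided difference quotients\<close>

lemma tendsto_difference_quotient_imp_tendsto:
  fixes f :: "real \<Rightarrow> real"
  assumes "((\<lambda>h. (f h - l) / h) \<longlongrightarrow> d) (at 0 within S)"
  shows "(f \<longlongrightarrow> l) (at 0 within S)"
proof -
  have "((\<lambda>h. (f h - l) / h * h + l) \<longlongrightarrow> d * 0 + l) (at 0 within S)"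
    by (intro tendsto_intros assms)
  moreover have "\<forall>\<^sub>F h in at 0 within S. (f h - l) / h * h + l = f h"
    by (rule eventually_at_filter[THEN iffD2]) (simp add: always_eventually)
  ultimately show ?thesis
    using tendsto_cong by fastforce
qed

lemma difference_quotient_bound:
  fixes f :: "real \<Rightarrow> real"
  assumes r: "((\<lambda>h. (f (x + h) - f x) / h) \<longlongrightarrow> a) (at_right 0)"
    and l: "((\<lambda>h. (f (x + h) - f x) / h) \<longlongrightarrow> b) (at_left 0)"
  shows "\<exists>M d. d > 0 \<and> (\<forall>h. \<bar>h\<bar> < d \<longrightarrow> \<bar>f (x + h) - f x\<bar> \<le> M * \<bar>h\<bar>)"
proof -
  define M where "M = max \<bar>a\<bar> \<bar>b\<bar> + 1"
  have "\<forall>\<^sub>F h in at_right 0. \<bar>(f (x + h) - f x) / h\<bar> < M"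
    by (rule order_tendstoD(2)[OF tendsto_rabs[OF r]]) (auto simp: M_def)
  moreover have "\<forall>\<^sub>F h in at_left 0. \<bar>(f (x + h) - f x) / h\<bar> < M"
    by (rule order_tendstoD(2)[OF tendsto_rabs[OF l]]) (auto simp: M_def)
  ultimately have "\<forall>\<^sub>F h in at 0. \<bar>(f (x + h) - f x) / h\<bar> < M"
    by (simp add: eventually_at_split)
  then obtain d where d: "d > 0" "\<And>h. h \<noteq> 0 \<Longrightarrow> \<bar>h\<bar> < d \<Longrightarrow> \<bar>(f (x + h) - f x) / h\<bar> < M"
    unfolding eventually_at by (auto simp: dist_real_def)
  have "\<bar>f (x + h) - f x\<bar> \<le> M * \<bar>h\<bar>" if "\<bar>h\<bar> < d" for h
    using d(2)[OF _ that] by (cases "h = 0") (auto simp: field_simps)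
  then show ?thesis using d(1) by blast
qed

subsection \<open>Constancy along the characteristics\<close>

lemma open_square:
  assumes "open A" "(x, t) \<in> A"
  obtains e where "e > 0" "\<And>x' t'. \<bar>x' - x\<bar> < e \<Longrightarrow> \<bar>t' - t\<bar> < e \<Longrightarrow> (x', t') \<in> (A :: (real \<times> real) set)"
proof -
  obtain B C where BC: "open B" "open C" "(x, t) \<in> B \<times> C" "B \<times> C \<subseteq> A"
    using open_prod_elim[OF assms] by auto
  obtain d1 where "d1 > 0" "\<And>y. dist y x < d1 \<Longrightarrow> y \<in> B"
    using BC open_dist by (metis mem_Sigma_iff)
  moreover obtain d2 where "d2 > 0" "\<And>y. dist y t < d2 \<Longrightarrow> y \<in> C"
    using BC open_dist by (metis mem_Sigma_iff)
  ultimately show thesis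
    using BC(4) by (intro that[of "min d1 d2"]) (auto simp: dist_real_def)
qed

text \<open>If no \<open>E n\<close> contained a portion of \<open>S\<close>, the sets
  \<open>S - E n\<close> would all be open and dense in \<open>S\<close>, yet their intersection is
  empty.\<close>

lemma Baire_closed_cover:
  fixes S :: "'a :: {real_normed_vector, heine_borel} set"
  assumes "closed S" "S \<noteq> {}" "S \<subseteq> (\<Union>n::nat. E n)" "\<And>n. closed (E n)"
  shows "\<exists>n w r. w \<in> S \<and> r > 0 \<and> ball w r \<inter> S \<subseteq> E n"
proof (rule ccontr)
  assume neg: "\<not> ?thesis"
  have "S \<subseteq> closure (\<Inter> (range (\<lambda>n. S - E n)))"
  proof (rule Baire[OF assms(1)])
    fix T assume "T \<in> range (\<lambda>n. S - E n)"
    then obtain n where n: "T = S - E n" by auto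
    have "S \<subseteq> closure T"
    proof
      fix w assume w: "w \<in> S"
      show "w \<in> closure T" unfolding closure_approachable
      proof (intro allI impI)
        fix r :: real assume "r > 0"
        then obtain v where "v \<in> ball w r" "v \<in> S" "v \<notin> E n" using neg w by blast
        then show "\<exists>y\<in>T. dist y w < r" using n by (auto simp: dist_commute)
      qed
    qed
    moreover have "openin (top_of_set S) T"
      unfolding n using assms(4)[of n] by (auto simp: openin_open intro!: exI[of _ "- E n"])
    ultimately show "openin (top_of_set S) T \<and> S \<subseteq> closure T" by simp
  qed auto
  moreover have "\<Inter> (range (\<lambda>n. S - E n)) = {}" using assms(3) by auto
  ultimately have "S \<subseteq> closure {}" by (simp only:)
  then show False using assms(2) by simp
qed

section \<open>Regular points and constancy along regular segments\<close>

text \<open>\<open>a\<close> and \<open>b\<close> are the right and left slopes in \<open>x\<close>.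
  Those in \<open>t\<close> are swapped and negated, as for a function of \<open>x - t\<close>,
  whose argument decreases when \<open>t\<close> grows. Directly, these limits give continuity only
  in each variable separately.\<close>

locale transport =
  fixes U :: "real \<Rightarrow> real \<Rightarrow> real" and \<Omega> :: "(real \<times> real) set" and a b :: "real \<Rightarrow> real \<Rightarrow> real"
  assumes open_dom: "open \<Omega>"
    and x_right: "(x, t) \<in> \<Omega> \<Longrightarrow> ((\<lambda>h. (U (x + h) t - U x t) / h) \<longlongrightarrow> a x t) (at_right 0)"
    and x_left: "(x, t) \<in> \<Omega> \<Longrightarrow> ((\<lambda>h. (U (x + h) t - U x t) / h) \<longlongrightarrow> b x t) (at_left 0)"
    and t_right: "(x, t) \<in> \<Omega> \<Longrightarrow> ((\<lambda>h. (U x (t + h) - U x t) / h) \<longlongrightarrow> - b x t) (at_right 0)"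
    and t_left: "(x, t) \<in> \<Omega> \<Longrightarrow> ((\<lambda>h. (U x (t + h) - U x t) / h) \<longlongrightarrow> - a x t) (at_left 0)"
begin

lemma isCont_x:
  assumes "(x, t) \<in> \<Omega>"
  shows "isCont (\<lambda>x. U x t) x"
proof -
  have "((\<lambda>h. U (x + h) t) \<longlongrightarrow> U x t) (at 0)"
    using tendsto_difference_quotient_imp_tendsto[OF x_right[OF assms]]
      tendsto_difference_quotient_imp_tendsto[OF x_left[OF assms]]
    by (simp add: filterlim_at_split)
  then show ?thesis
    by (simp add: isCont_iff)
qed

lemma isCont_t:
  assumes "(x, t) \<in> \<Omega>"
  shows "isCont (\<lambda>t. U x t) t"
proof -
  have "((\<lambda>h. U x (t + h)) \<longlongrightarrow> U x t) (at 0)"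
    using tendsto_difference_quotient_imp_tendsto[OF t_right[OF assms]]
      tendsto_difference_quotient_imp_tendsto[OF t_left[OF assms]]
    by (simp add: filterlim_at_split)
  then show ?thesis
    by (simp add: isCont_iff)
qed

definition regular :: "real \<Rightarrow> real \<Rightarrow> bool" where
  "regular x t \<longleftrightarrow> (x, t) \<in> \<Omega> \<and>
     (\<exists>e>0. \<forall>x' t' k. \<bar>x' - x\<bar> < e \<and> \<bar>t' - t\<bar> < e \<and> \<bar>x' + k - x\<bar> < e \<and> \<bar>t' + k - t\<bar> < e \<longrightarrow>
        U (x' + k) (t' + k) = U x' t')"

lemma regular_square:
  assumes "regular x t"
  obtains e where "e > 0" "\<And>x' t'. \<bar>x' - x\<bar> < e \<Longrightarrow> \<bar>t' - t\<bar> < e \<Longrightarrow> regular x' t'"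
proof -
  obtain e where e: "e > 0" "\<And>x' t' k. \<bar>x' - x\<bar> < e \<and> \<bar>t' - t\<bar> < e \<and> \<bar>x' + k - x\<bar> < e \<and> \<bar>t' + k - t\<bar> < e \<Longrightarrow>
        U (x' + k) (t' + k) = U x' t'"
    using assms unfolding regular_def by blast
  obtain d where d: "d > 0" "\<And>x' t'. \<bar>x' - x\<bar> < d \<Longrightarrow> \<bar>t' - t\<bar> < d \<Longrightarrow> (x', t') \<in> \<Omega>"
    using open_square[OF open_dom] assms unfolding regular_def by blast
  \<comment> \<open>Halving keeps the square of radius \<open>r\<close> about any point of the
    \<open>r\<close>-square inside the \<open>e\<close>-square.\<close>
  define r where "r = min d e / 2"
  have r: "r > 0" "r < d" "2 * r \<le> e" using d(1) e(1) by (auto simp: r_def)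
  show thesis
  proof (rule that[of r])
    fix x' t' assume *: "\<bar>x' - x\<bar> < r" "\<bar>t' - t\<bar> < r"
    have "U (y + k) (s + k) = U y s"
      if "\<bar>y - x'\<bar> < r \<and> \<bar>s - t'\<bar> < r \<and> \<bar>y + k - x'\<bar> < r \<and> \<bar>s + k - t'\<bar> < r" for y s k
      using that * r unfolding abs_less_iff by (intro e(2)) (unfold abs_less_iff, linarith)
    moreover have "(x', t') \<in> \<Omega>"
      using * r unfolding abs_less_iff by (intro d(2)) (unfold abs_less_iff, linarith+)
    ultimately show "regular x' t'" unfolding regular_def using r(1) by blast
  qed (use r in auto)
qed

lemma constant_along_characteristic:
  assumes reg: "\<And>s. s1 \<le> s \<Longrightarrow> s \<le> s2 \<Longrightarrow> regular (x + s) (t + s)" and "s1 \<le> s2"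
  shows "U (x + s1) (t + s1) = U (x + s2) (t + s2)"
proof (rule connected_local_const[of "{s1..s2}" s1 s2 "\<lambda>s. U (x + s) (t + s)"])
  show "\<forall>r\<in>{s1..s2}. \<forall>\<^sub>F s in at r within {s1..s2}. U (x + r) (t + r) = U (x + s) (t + s)"
  proof
    fix r assume "r \<in> {s1..s2}"
    then have "regular (x + r) (t + r)" using reg by auto
    then obtain e where e: "e > 0" "\<And>x' t' k. \<bar>x' - (x + r)\<bar> < e \<and> \<bar>t' - (t + r)\<bar> < e \<and>
        \<bar>x' + k - (x + r)\<bar> < e \<and> \<bar>t' + k - (t + r)\<bar> < e \<Longrightarrow> U (x' + k) (t' + k) = U x' t'"
      unfolding regular_def by blast
    have "U (x + r) (t + r) = U (x + s) (t + s)" if "dist s r < e" for s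
      using e(2)[of "x + r" "t + r" "s - r"] e(1) that by (simp add: dist_real_def)
    then show "\<forall>\<^sub>F s in at r within {s1..s2}. U (x + r) (t + r) = U (x + s) (t + s)"
      unfolding eventually_at using e(1) by blast
  qed
qed (use assms(2) in auto)

lemma open_regular: "open {(x, t). regular x t}"
proof (subst open_dist, safe)
  fix x t assume "regular x t"
  then obtain e where e: "e > 0" "\<And>x' t'. \<bar>x' - x\<bar> < e \<Longrightarrow> \<bar>t' - t\<bar> < e \<Longrightarrow> regular x' t'"
    using regular_square by blast
  have "regular x' t'" if "dist (x', t') (x, t) < e" for x' t'
    using dist_fst_le[of "(x', t')" "(x, t)"] dist_snd_le[of "(x', t')" "(x, t)"] that
    by (intro e(2)) (auto simp: dist_real_def)
  then show "\<exists>e>0. \<forall>y. dist y (x, t) < e \<longrightarrow> y \<in> {(x, t). regular x t}"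
    using e(1) by (intro exI[of _ e]) auto
qed

lemma closed_singular_section:
  "closed {s. \<not> regular (x + s) t}" "closed {s. \<not> regular (x + s) (t + s)}"
proof -
  have "open ((\<lambda>s. (x + s, t)) -` {(x, t). regular x t})"
    by (intro open_vimage open_regular continuous_intros)
  then show "closed {s. \<not> regular (x + s) t}"
    by (simp add: closed_def Compl_eq vimage_def)
  have "open ((\<lambda>s. (x + s, t + s)) -` {(x, t). regular x t})"
    by (intro open_vimage open_regular continuous_intros)
  then show "closed {s. \<not> regular (x + s) (t + s)}"
    by (simp add: closed_def Compl_eq vimage_def)
qed

text \<open>The sign \<open>\<sigma>\<close> lets later arguments treat both directions along a
  characteristic at once.\<close>

lemma constant_along_oriented_characteristic:
  assumes reg: "\<And>s. s1 \<le> s \<Longrightarrow> s \<le> s2 \<Longrightarrow> regular (x + \<sigma> * s) (t + \<sigma> * s)" and "s1 \<le> s2"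
    and \<sigma>: "\<sigma> = 1 \<or> \<sigma> = -1"
  shows "U (x + \<sigma> * s1) (t + \<sigma> * s1) = U (x + \<sigma> * s2) (t + \<sigma> * s2)"
proof (cases "\<sigma> = 1")
  case True
  then show ?thesis using constant_along_characteristic[of s1 s2 x t] assms by simp
next
  case False
  then have \<sigma>: "\<sigma> = -1" using assms by simp
  have "regular (x + s) (t + s)" if "- s2 \<le> s" "s \<le> - s1" for s
    using reg[of "- s"] that \<sigma> by simp
  then show ?thesis using constant_along_characteristic[of "- s2" "- s1" x t] assms(2) \<sigma> by simp
qed

section \<open>A square around a singular point with uniformly bounded quotients\<close>

text \<open>
  Separate continuity suffices for the sets below to be closed: a limit of points on which the
  difference quotients are uniformly bounded is reached along a horizontal or vertical detour.
\<close>

lemma closed_bounded_quotients: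
  assumes S: "closed S" "\<And>x t h. (x, t) \<in> S \<Longrightarrow> \<bar>h\<bar> < d \<Longrightarrow> (x + h, t) \<in> \<Omega> \<and> (x, t + h) \<in> \<Omega>"
    and d: "d > 0"
  shows "closed {(x, t) \<in> S. \<forall>h. \<bar>h\<bar> < d \<longrightarrow>
      \<bar>U (x + h) t - U x t\<bar> \<le> M * \<bar>h\<bar> \<and> \<bar>U x (t + h) - U x t\<bar> \<le> M * \<bar>h\<bar>}" (is "closed ?E")
proof (subst closed_sequential_limits, intro allI impI, elim conjE)
  fix p l assume p: "\<forall>n. p n \<in> ?E" "p \<longlonglongrightarrow> l"
  obtain x t where l: "l = (x, t)" by (cases l)
  define X T where "X n = fst (p n)" and "T n = snd (p n)" for n
  have XT: "X \<longlonglongrightarrow> x" "T \<longlonglongrightarrow> t"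
    using tendsto_fst[OF p(2)] tendsto_snd[OF p(2)] unfolding X_def T_def l by simp_all
  have pE: "\<bar>U (X n + h) (T n) - U (X n) (T n)\<bar> \<le> M * \<bar>h\<bar>"
     "\<bar>U (X n) (T n + h) - U (X n) (T n)\<bar> \<le> M * \<bar>h\<bar>" if "\<bar>h\<bar> < d" for n h
    using p(1)[rule_format, of n] that by (auto simp: X_def T_def case_prod_beta)
  have pE': "\<bar>y - X n\<bar> < d \<Longrightarrow> \<bar>U y (T n) - U (X n) (T n)\<bar> \<le> M * \<bar>y - X n\<bar>"
     "\<bar>y - T n\<bar> < d \<Longrightarrow> \<bar>U (X n) y - U (X n) (T n)\<bar> \<le> M * \<bar>y - T n\<bar>" for y n
    using pE(1)[of "y - X n" n] pE(2)[of "y - T n" n] by auto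
  have lS: "(x, t) \<in> S"
    using closed_sequentially[OF S(1) _ p(2)] p(1) l by (auto simp: case_prod_beta)
  have limx: "(\<lambda>n. M * \<bar>x + h - X n\<bar>) \<longlonglongrightarrow> M * \<bar>h\<bar>" for h
    by (rule tendsto_eq_intros XT | simp)+
  have limt: "(\<lambda>n. M * \<bar>t + h - T n\<bar>) \<longlonglongrightarrow> M * \<bar>h\<bar>" for h
    by (rule tendsto_eq_intros XT | simp)+
  have evx: "\<forall>\<^sub>F n in sequentially. \<bar>U (x + h) (T n) - U (X n) (T n)\<bar> \<le> M * \<bar>x + h - X n\<bar>"
    if "\<bar>h\<bar> < d" for h
  proof -
    have "(\<lambda>n. \<bar>x + h - X n\<bar>) \<longlonglongrightarrow> \<bar>h\<bar>" by (rule tendsto_eq_intros XT | simp)+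
    from order_tendstoD(2)[OF this that] show ?thesis
      by (rule eventually_mono) (rule pE'(1))
  qed
  have evt: "\<forall>\<^sub>F n in sequentially. \<bar>U (X n) (t + h) - U (X n) (T n)\<bar> \<le> M * \<bar>t + h - T n\<bar>"
    if "\<bar>h\<bar> < d" for h
  proof -
    have "(\<lambda>n. \<bar>t + h - T n\<bar>) \<longlonglongrightarrow> \<bar>h\<bar>" by (rule tendsto_eq_intros XT | simp)+
    from order_tendstoD(2)[OF this that] show ?thesis
      by (rule eventually_mono) (rule pE'(2))
  qed
  have Ux: "(\<lambda>n. U (x + h) (T n)) \<longlonglongrightarrow> U (x + h) t" if "\<bar>h\<bar> < d" for h
    by (rule isCont_tendsto_compose[OF isCont_t XT(2)]) (use S(2)[OF lS that] in simp)
  have Ut: "(\<lambda>n. U (X n) (t + h)) \<longlonglongrightarrow> U x (t + h)" if "\<bar>h\<bar> < d" for h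
    using isCont_tendsto_compose[OF isCont_x XT(1), of "t + h"] S(2)[OF lS that] by simp
  \<comment> \<open>The bound makes the horizontal increment from \<open>(X n, T n)\<close> to
    \<open>(x, T n)\<close> vanish in the limit, and \<open>U x (T n)\<close> converges by
    continuity in \<open>t\<close>.\<close>
  have lim: "(\<lambda>n. U (X n) (T n)) \<longlonglongrightarrow> U x t"
  proof -
    have "(\<lambda>n. U (x + 0) (T n) - U (X n) (T n)) \<longlonglongrightarrow> 0"
      by (rule Lim_null_comparison[OF _ limx[of 0, simplified]])
        (use evx[of 0] d in \<open>simp add: abs_minus_commute\<close>)
    from tendsto_diff[OF Ux[of 0] this] d show ?thesis by simp
  qed
  have "\<bar>U (x + h) t - U x t\<bar> \<le> M * \<bar>h\<bar> \<and> \<bar>U x (t + h) - U x t\<bar> \<le> M * \<bar>h\<bar>" if "\<bar>h\<bar> < d" for h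
    using tendsto_le[OF _ limx tendsto_rabs[OF tendsto_diff[OF Ux[OF that] lim]] evx[OF that]]
      tendsto_le[OF _ limt tendsto_rabs[OF tendsto_diff[OF Ut[OF that] lim]] evt[OF that]]
    by simp
  then show "l \<in> ?E" using l lS by auto
qed

text \<open>\<open>E n\<close> collects the points of \<open>S\<close> whose quotients are bounded
  by \<open>n + 1\<close> at scale \<open>d / (n + 1)\<close>. The one-sided slopes put every point
  of \<open>S\<close> into some \<open>E n\<close>, and Baire's theorem makes one bound uniform on a
  portion of the singular set.\<close>

lemma singular_portion:
  assumes sing: "(x0, t0) \<in> \<Omega>" "\<not> regular x0 t0"
  obtains x1 t1 e N where "\<not> regular x1 t1" "e > 0" "N \<ge> 0"
    "\<And>x t. \<bar>x - x1\<bar> < e \<Longrightarrow> \<bar>t - t1\<bar> < e \<Longrightarrow> (x, t) \<in> \<Omega>"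
    "\<And>x t x'. \<not> regular x t \<Longrightarrow> \<bar>x - x1\<bar> < e \<Longrightarrow> \<bar>t - t1\<bar> < e \<Longrightarrow> \<bar>x' - x1\<bar> < e \<Longrightarrow>
       \<bar>U x' t - U x t\<bar> \<le> N * \<bar>x' - x\<bar>"
    "\<And>x t t'. \<not> regular x t \<Longrightarrow> \<bar>x - x1\<bar> < e \<Longrightarrow> \<bar>t - t1\<bar> < e \<Longrightarrow> \<bar>t' - t1\<bar> < e \<Longrightarrow>
       \<bar>U x t' - U x t\<bar> \<le> N * \<bar>t' - t\<bar>"
proof -
  obtain d0 where d0: "d0 > 0" "\<And>x t. \<bar>x - x0\<bar> < d0 \<Longrightarrow> \<bar>t - t0\<bar> < d0 \<Longrightarrow> (x, t) \<in> \<Omega>"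
    using open_square[OF open_dom sing(1)] by blast
  \<comment> \<open>With half of \<open>d0\<close>, points of the closed box moved by less than
    \<open>d\<close> along an axis stay in \<open>\<Omega>\<close>.\<close>
  define d where "d = d0 / 2"
  have d: "d > 0" "d0 = 2 * d" using d0 by (auto simp: d_def)
  define box where "box = ball x0 d \<times> ball t0 d"
  have box: "open box" unfolding box_def by (intro open_Times open_ball)
  define R where "R = {(x, t). regular x t}"
  define S where "S = closure (box - R)"
  have "S \<subseteq> cball x0 d \<times> cball t0 d - R"
    unfolding S_def
  proof (rule closure_minimal)
    show "closed (cball x0 d \<times> cball t0 d - R)"
      using open_regular by (intro closed_Diff closed_Times) (auto simp: R_def)
  qed (auto simp: box_def)
  then have S: "\<bar>x - x0\<bar> \<le> d \<and> \<bar>t - t0\<bar> \<le> d \<and> \<not> regular x t" if "(x, t) \<in> S" for x t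
    using that by (auto simp: R_def dist_real_def)
  have S_dom: "(x + h, t) \<in> \<Omega> \<and> (x, t + h) \<in> \<Omega>" if "(x, t) \<in> S" "\<bar>h\<bar> < d" for x t h
    using S[OF that(1)] that(2) d by (intro conjI d0(2)) linarith+
  define E where "E n = {(x, t) \<in> S. \<forall>h. \<bar>h\<bar> < d / (real n + 1) \<longrightarrow>
      \<bar>U (x + h) t - U x t\<bar> \<le> (real n + 1) * \<bar>h\<bar> \<and> \<bar>U x (t + h) - U x t\<bar> \<le> (real n + 1) * \<bar>h\<bar>}" for n
  have small: "d / (real n + 1) \<le> d" for n using d by (simp add: field_simps)
  have "closed (E n)" for n
    unfolding E_def
  proof (rule closed_bounded_quotients)
    show "(x + h, t) \<in> \<Omega> \<and> (x, t + h) \<in> \<Omega>" if "(x, t) \<in> S" "\<bar>h\<bar> < d / (real n + 1)" for x t h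
      using S_dom that small[of n] by force
  qed (use d in \<open>auto simp: S_def\<close>)
  moreover have "S \<subseteq> (\<Union>n. E n)"
  proof
    fix p assume p: "p \<in> S"
    obtain x t where xt: "p = (x, t)" by (cases p)
    have dom: "(x, t) \<in> \<Omega>" using S_dom[of x t 0] p xt d by simp
    obtain M1 d1 where 1: "d1 > 0" "\<And>h. \<bar>h\<bar> < d1 \<Longrightarrow> \<bar>U (x + h) t - U x t\<bar> \<le> M1 * \<bar>h\<bar>"
      using difference_quotient_bound[OF x_right[OF dom] x_left[OF dom]] by blast
    obtain M2 d2 where 2: "d2 > 0" "\<And>h. \<bar>h\<bar> < d2 \<Longrightarrow> \<bar>U x (t + h) - U x t\<bar> \<le> M2 * \<bar>h\<bar>"
      using difference_quotient_bound[OF t_right[OF dom] t_left[OF dom]] by blast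
    \<comment> \<open>\<open>n\<close> dominates both local constants and makes the scale
      \<open>d / (n + 1)\<close> no larger than \<open>d1\<close> and \<open>d2\<close>.\<close>
    obtain n :: nat where n: "real n \<ge> max (max M1 M2) (d / min d1 d2)"
      using real_arch_simple by blast
    have n': "M1 \<le> real n + 1" "M2 \<le> real n + 1" using n by auto
    have "d / min d1 d2 \<le> real n + 1" using n by auto
    then have n'': "d / (real n + 1) \<le> min d1 d2"
      using 1(1) 2(1) by (simp add: pos_divide_le_eq mult.commute del: min_less_iff_conj min.bounded_iff)
    have "\<bar>U (x + h) t - U x t\<bar> \<le> (real n + 1) * \<bar>h\<bar> \<and> \<bar>U x (t + h) - U x t\<bar> \<le> (real n + 1) * \<bar>h\<bar>"
      if h: "\<bar>h\<bar> < d / (real n + 1)" for h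
    proof -
      have "\<bar>h\<bar> < d1" "\<bar>h\<bar> < d2" using h n'' by auto
      then show ?thesis
        using 1(2)[of h] 2(2)[of h] mult_right_mono[OF n'(1), of "\<bar>h\<bar>"] mult_right_mono[OF n'(2), of "\<bar>h\<bar>"]
        by linarith
    qed
    then have "p \<in> E n" unfolding E_def using p xt by auto
    then show "p \<in> (\<Union>n. E n)" by blast
  qed
  moreover have "(x0, t0) \<in> S"
    unfolding S_def using sing d by (intro subsetD[OF closure_subset]) (auto simp: box_def R_def)
  ultimately obtain n w r where w: "w \<in> S" "r > 0" "ball w r \<inter> S \<subseteq> E n"
    using Baire_closed_cover[of S E] closed_closure[of "box - R", folded S_def] by blast
  \<comment> \<open>The point \<open>w\<close> may lie on the boundary of the box. A singular point
    inside the box is taken as centre instead, so that all singular points close to it belong to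
    \<open>S\<close>.\<close>
  obtain p where p: "p \<in> box - R" "dist p w < r"
    using w(1,2) unfolding S_def closure_approachable by blast
  obtain x1 t1 where xt: "p = (x1, t1)" by (cases p)
  have "(x1, t1) \<in> ball w r \<inter> box" using p xt by (auto simp: dist_commute)
  then obtain e0 where e0: "e0 > 0"
      "\<And>x t. \<bar>x - x1\<bar> < e0 \<Longrightarrow> \<bar>t - t1\<bar> < e0 \<Longrightarrow> (x, t) \<in> ball w r \<inter> box"
    using open_square[of "ball w r \<inter> box" x1 t1] box by blast
  define \<delta> where "\<delta> = d / (real n + 1)"
  have \<delta>: "\<delta> > 0" using d by (simp add: \<delta>_def)
  \<comment> \<open>With \<open>e\<close> at most half the scale, two points of the square on a
    common axis-parallel line are closer than \<open>\<delta>\<close>.\<close>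
  define e where "e = min e0 (\<delta> / 2)"
  have e: "e > 0" "e \<le> e0" "2 * e \<le> \<delta>"
    using e0(1) \<delta> by (auto simp: e_def)
  have in_E: "(x, t) \<in> E n" if "\<not> regular x t" "\<bar>x - x1\<bar> < e" "\<bar>t - t1\<bar> < e" for x t
  proof -
    have "(x, t) \<in> ball w r \<inter> box" using e0(2) that e(2) by simp
    moreover from this have "(x, t) \<in> S"
      unfolding S_def using that by (intro subsetD[OF closure_subset]) (auto simp: R_def)
    ultimately show ?thesis using w(3) by blast
  qed
  show thesis
  proof (rule that[of x1 t1 e "real n + 1"])
    show "\<not> regular x1 t1" using p xt by (auto simp: R_def)
    show "(x, t) \<in> \<Omega>" if *: "\<bar>x - x1\<bar> < e" "\<bar>t - t1\<bar> < e" for x t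
    proof -
      have "(x, t) \<in> box" using e0(2) * e(2) by simp
      then show ?thesis using d by (intro d0(2)) (auto simp: box_def dist_real_def abs_minus_commute)
    qed
    show "\<bar>U x' t - U x t\<bar> \<le> (real n + 1) * \<bar>x' - x\<bar>"
      if *: "\<not> regular x t" "\<bar>x - x1\<bar> < e" "\<bar>t - t1\<bar> < e" "\<bar>x' - x1\<bar> < e" for x t x'
    proof -
      have "\<bar>x' - x\<bar> < \<delta>" using * e by linarith
      then have "\<bar>U (x + (x' - x)) t - U x t\<bar> \<le> (real n + 1) * \<bar>x' - x\<bar>"
        using in_E[OF *(1-3)] unfolding E_def \<delta>_def by blast
      then show ?thesis by simp
    qed
    show "\<bar>U x t' - U x t\<bar> \<le> (real n + 1) * \<bar>t' - t\<bar>"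
      if *: "\<not> regular x t" "\<bar>x - x1\<bar> < e" "\<bar>t - t1\<bar> < e" "\<bar>t' - t1\<bar> < e" for x t t'
    proof -
      have "\<bar>t' - t\<bar> < \<delta>" using * e by linarith
      then have "\<bar>U x (t + (t' - t)) - U x t\<bar> \<le> (real n + 1) * \<bar>t' - t\<bar>"
        using in_E[OF *(1-3)] unfolding E_def \<delta>_def by blast
      then show ?thesis by simp
    qed
  qed (use e in auto)
qed

section \<open>Constancy in a square with uniformly bounded quotients\<close>

context
  fixes x1 t1 e N :: real
  assumes e: "e > 0" and N: "N \<ge> 0"
    and dom: "\<And>x t. \<bar>x - x1\<bar> < e \<Longrightarrow> \<bar>t - t1\<bar> < e \<Longrightarrow> (x, t) \<in> \<Omega>"
    and lip_x: "\<And>x t x'. \<not> regular x t \<Longrightarrow> \<bar>x - x1\<bar> < e \<Longrightarrow> \<bar>t - t1\<bar> < e \<Longrightarrow> \<bar>x' - x1\<bar> < e \<Longrightarrow>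
       \<bar>U x' t - U x t\<bar> \<le> N * \<bar>x' - x\<bar>"
    and lip_t: "\<And>x t t'. \<not> regular x t \<Longrightarrow> \<bar>x - x1\<bar> < e \<Longrightarrow> \<bar>t - t1\<bar> < e \<Longrightarrow> \<bar>t' - t1\<bar> < e \<Longrightarrow>
       \<bar>U x t' - U x t\<bar> \<le> N * \<bar>t' - t\<bar>"
begin

text \<open>
  Either singular points accumulate at (x, t) in the triangle between the characteristic and the
  vertical line through (x, t), and the Lipschitz bounds there force the value; or the triangle
  is regular near (x, t), and the constancy along its characteristics carries the value from the
  vertical side to the given characteristic.
\<close>

lemma value_at_end_of_regular_characteristic:
  assumes xt: "\<not> regular x t" "\<bar>x - x1\<bar> < e" "\<bar>t - t1\<bar> < e"
    and \<sigma>: "\<sigma> = 1 \<or> \<sigma> = -1" and K: "K > 0"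
    and K_in: "\<bar>x + \<sigma> * K - x1\<bar> < e" "\<bar>t + \<sigma> * K - t1\<bar> < e"
    and reg: "\<And>k. 0 < k \<Longrightarrow> k \<le> K \<Longrightarrow> regular (x + \<sigma> * k) (t + \<sigma> * k)"
  shows "U (x + \<sigma> * K) (t + \<sigma> * K) = U x t"
proof -
  define c where "c = U (x + \<sigma> * K) (t + \<sigma> * K)"
  have c: "U (x + \<sigma> * k) (t + \<sigma> * k) = c" if "0 < k" "k \<le> K" for k
    unfolding c_def by (rule constant_along_oriented_characteristic) (use that reg \<sigma> in auto)
  have sq: "\<bar>x + \<sigma> * k - x1\<bar> < e" "\<bar>t + \<sigma> * k - t1\<bar> < e" if "0 \<le> k" "k \<le> K" for k
    using \<sigma> that K_in xt(2,3) by (auto simp: abs_less_iff)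
  \<comment> \<open>The path runs horizontally from the characteristic to the given singular point,
    on to the vertical line through \<open>x\<close>, and down or up that line to
    \<open>(x, t)\<close>. Each leg has a singular endpoint, as the Lipschitz bounds require; the
    lengths are \<open>\<tau>\<close>, \<open>s - \<tau>\<close> and \<open>s\<close>.\<close>
  have near: "\<bar>c - U x t\<bar> \<le> 2 * N * s"
    if s: "0 < s" "s \<le> K" "0 \<le> \<tau>" "\<tau> \<le> s" and sing: "\<not> regular (x + \<sigma> * (s - \<tau>)) (t + \<sigma> * s)" for s \<tau>
  proof -
    have "\<bar>U (x + \<sigma> * s) (t + \<sigma> * s) - U (x + \<sigma> * (s - \<tau>)) (t + \<sigma> * s)\<bar>
        \<le> N * \<bar>(x + \<sigma> * s) - (x + \<sigma> * (s - \<tau>))\<bar>"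
      using s by (intro lip_x sing sq) auto
    moreover have "\<bar>(x + \<sigma> * s) - (x + \<sigma> * (s - \<tau>))\<bar> = \<tau>" using \<sigma> s by (auto simp: algebra_simps)
    moreover have "\<bar>U x (t + \<sigma> * s) - U (x + \<sigma> * (s - \<tau>)) (t + \<sigma> * s)\<bar> \<le> N * \<bar>x - (x + \<sigma> * (s - \<tau>))\<bar>"
      using s by (intro lip_x sing sq xt) auto
    moreover have "\<bar>x - (x + \<sigma> * (s - \<tau>))\<bar> = s - \<tau>" using \<sigma> s by auto
    moreover have "\<bar>U x (t + \<sigma> * s) - U x t\<bar> \<le> N * \<bar>t + \<sigma> * s - t\<bar>"
      using s by (intro lip_t sq xt) auto
    moreover have "\<bar>t + \<sigma> * s - t\<bar> = s" using \<sigma> s by auto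
    moreover have "N * \<tau> + N * (s - \<tau>) + N * s = 2 * N * s" by (simp add: algebra_simps)
    ultimately show ?thesis using c[of s] s by auto
  qed
  show ?thesis
  proof (cases "\<forall>\<delta>>0. \<exists>s \<tau>. 0 < s \<and> s < \<delta> \<and> s \<le> K \<and> 0 \<le> \<tau> \<and> \<tau> \<le> s \<and>
      \<not> regular (x + \<sigma> * (s - \<tau>)) (t + \<sigma> * s)")
    case True
    have "\<bar>c - U x t\<bar> \<le> \<epsilon>" if "\<epsilon> > 0" for \<epsilon>
    proof -
      \<comment> \<open>The denominator \<open>2 * N + 1\<close> is positive even for
        \<open>N = 0\<close> and yields \<open>2 * N * s < \<epsilon>\<close>.\<close>
      obtain s \<tau> where s: "0 < s" "s < \<epsilon> / (2 * N + 1)" "s \<le> K" "0 \<le> \<tau>" "\<tau> \<le> s"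
          "\<not> regular (x + \<sigma> * (s - \<tau>)) (t + \<sigma> * s)"
        using True[rule_format, of "\<epsilon> / (2 * N + 1)"] \<open>\<epsilon> > 0\<close> N by auto
      have "2 * N * s + s < \<epsilon>" using s(2) N by (simp add: field_simps)
      then show ?thesis using near[of s \<tau>] s by linarith
    qed
    then have "\<bar>c - U x t\<bar> \<le> 0" by (rule field_le_epsilon) simp
    then show ?thesis unfolding c_def by simp
  next
    case False
    then obtain \<delta> where \<delta>: "\<delta> > 0" "\<And>s \<tau>. 0 < s \<Longrightarrow> s < \<delta> \<Longrightarrow> s \<le> K \<Longrightarrow> 0 \<le> \<tau> \<Longrightarrow> \<tau> \<le> s \<Longrightarrow>
        regular (x + \<sigma> * (s - \<tau>)) (t + \<sigma> * s)" by blast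
    define s0 where "s0 = min \<delta> K / 2"
    have s0: "0 < s0" "s0 < \<delta>" "s0 \<le> K" using \<delta>(1) K by (auto simp: s0_def)
    \<comment> \<open>The characteristic through \<open>(x, t + \<sigma> * \<tau>)\<close> stays in
      the regular triangle up to height \<open>t + \<sigma> * s0\<close>. As \<open>\<tau>\<close>
      tends to 0, continuity in \<open>t\<close> on the vertical side and in \<open>x\<close> on the
      horizontal side identifies the two limits.\<close>
    have "U x (t + \<sigma> * \<tau>) = U (x + \<sigma> * (s0 - \<tau>)) (t + \<sigma> * s0)" if "0 < \<tau>" "\<tau> < s0" for \<tau>
    proof -
      have "U ((x - \<sigma> * \<tau>) + \<sigma> * \<tau>) (t + \<sigma> * \<tau>) = U ((x - \<sigma> * \<tau>) + \<sigma> * s0) (t + \<sigma> * s0)"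
      proof (rule constant_along_oriented_characteristic)
        show "regular ((x - \<sigma> * \<tau>) + \<sigma> * s) (t + \<sigma> * s)" if "\<tau> \<le> s" "s \<le> s0" for s
          using \<delta>(2)[of s \<tau>] that \<open>0 < \<tau>\<close> s0 by (simp add: algebra_simps)
      qed (use that \<sigma> in auto)
      then show ?thesis by (simp add: algebra_simps)
    qed
    then have ev: "\<forall>\<^sub>F \<tau> in at_right 0. U x (t + \<sigma> * \<tau>) = U (x + \<sigma> * (s0 - \<tau>)) (t + \<sigma> * s0)"
      unfolding eventually_at_right_field using s0(1) by blast
    have lim: "((\<lambda>\<tau>. U x (t + \<sigma> * \<tau>)) \<longlongrightarrow> U x t) (at_right 0)"
      by (rule isCont_tendsto_compose[OF isCont_t]) (use dom xt in \<open>auto intro!: tendsto_eq_intros\<close>)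
    have "((\<lambda>\<tau>. U (x + \<sigma> * (s0 - \<tau>)) (t + \<sigma> * s0)) \<longlongrightarrow> U (x + \<sigma> * s0) (t + \<sigma> * s0)) (at_right 0)"
    proof (rule isCont_tendsto_compose[OF isCont_x])
      show "(x + \<sigma> * s0, t + \<sigma> * s0) \<in> \<Omega>" using s0 by (intro dom sq) auto
    qed (auto intro!: tendsto_eq_intros)
    then have "U x t = U (x + \<sigma> * s0) (t + \<sigma> * s0)"
      using tendsto_unique[OF trivial_limit_at_right_real Lim_transform_eventually[OF lim ev]] by simp
    then show ?thesis using c[OF s0(1,3)] c_def by simp
  qed
qed

text \<open>Between the first and the last singular point of the segment, a detour via the corner
  \<open>(x + s2, t + s1)\<close> has two legs, each anchored at a singular point. On the regular
  ends the value does not change, by \<open>value_at_end_of_regular_characteristic\<close>.\<close>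

lemma lipschitz_along_characteristic:
  assumes xt: "\<bar>x - x1\<bar> < e" "\<bar>t - t1\<bar> < e" and k: "k \<ge> 0"
    and xtk: "\<bar>x + k - x1\<bar> < e" "\<bar>t + k - t1\<bar> < e"
  shows "\<bar>U (x + k) (t + k) - U x t\<bar> \<le> 2 * N * k"
proof -
  define X where "X = {0..k} \<inter> {s. \<not> regular (x + s) (t + s)}"
  have X: "compact X"
    unfolding X_def by (intro compact_Int_closed closed_singular_section) simp
  have sq: "\<bar>x + s - x1\<bar> < e" "\<bar>t + s - t1\<bar> < e" if "0 \<le> s" "s \<le> k" for s
    using that xt xtk by (auto simp: abs_less_iff)
  show ?thesis
  proof (cases "X = {}")
    case True
    then have "regular (x + s) (t + s)" if "0 \<le> s" "s \<le> k" for s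
      using that by (auto simp: X_def)
    from constant_along_characteristic[OF this k] N k show ?thesis by simp
  next
    case False
    obtain s1 where s1: "s1 \<in> X" "\<And>s. s \<in> X \<Longrightarrow> s1 \<le> s"
      using compact_attains_inf[OF X False] by blast
    obtain s2 where s2: "s2 \<in> X" "\<And>s. s \<in> X \<Longrightarrow> s \<le> s2"
      using compact_attains_sup[OF X False] by blast
    have s: "0 \<le> s1" "s1 \<le> s2" "s2 \<le> k" using s1 s2 by (auto simp: X_def)
    have sing: "\<not> regular (x + s1) (t + s1)" "\<not> regular (x + s2) (t + s2)"
      using s1 s2 by (auto simp: X_def)
    have reg: "regular (x + s) (t + s)" if "0 \<le> s" "s \<le> k" "s < s1 \<or> s > s2" for s
      using s1(2)[of s] s2(2)[of s] that by (force simp: X_def)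
    have "U x t = U (x + s1) (t + s1)"
    proof (cases "s1 = 0")
      case False
      have "U (x + s1 + -1 * s1) (t + s1 + -1 * s1) = U (x + s1) (t + s1)"
      proof (rule value_at_end_of_regular_characteristic)
        show "regular (x + s1 + -1 * k') (t + s1 + -1 * k')" if "0 < k'" "k' \<le> s1" for k'
          using reg[of "s1 - k'"] that s by (simp add: algebra_simps)
      qed (use False s sq xt sing in auto)
      then show ?thesis by simp
    qed simp
    moreover have "U (x + k) (t + k) = U (x + s2) (t + s2)"
    proof (cases "s2 = k")
      case False
      have "U (x + s2 + 1 * (k - s2)) (t + s2 + 1 * (k - s2)) = U (x + s2) (t + s2)"
      proof (rule value_at_end_of_regular_characteristic)
        show "regular (x + s2 + 1 * k') (t + s2 + 1 * k')" if "0 < k'" "k' \<le> k - s2" for k'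
          using reg[of "s2 + k'"] that s by (simp add: algebra_simps)
      qed (use False s sq xtk sing in auto)
      then show ?thesis by simp
    qed simp
    moreover have "\<bar>U (x + s2) (t + s1) - U (x + s1) (t + s1)\<bar> \<le> N * \<bar>(x + s2) - (x + s1)\<bar>"
      using s by (intro lip_x sing sq) auto
    moreover have "\<bar>U (x + s2) (t + s1) - U (x + s2) (t + s2)\<bar> \<le> N * \<bar>(t + s1) - (t + s2)\<bar>"
      using s by (intro lip_t sing sq) auto
    moreover have "N * (s2 - s1) \<le> N * k" using s N by (intro mult_left_mono) auto
    ultimately show ?thesis using s by (auto simp: abs_if split: if_splits)
  qed
qed

text \<open>Dominated convergence requires sequences, and one-sided ones at that, since the slopes
  of \<open>U\<close> depend on the side. The radii \<open>e / 2\<close> for \<open>x\<close> and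
  \<open>y\<close> add up to keep \<open>(x + y, y)\<close> in the square.\<close>

lemma mean_quotient_tendsto_0:
  assumes A: "\<And>x. x \<in> {A..B} \<Longrightarrow> \<bar>x - (x1 - t1)\<bar> \<le> e / 2"
    and y: "\<bar>y - t1\<bar> < e / 2"
    and k: "\<And>n. \<bar>y + k n - t1\<bar> < e / 2"
    and k0: "filterlim k (at_right 0) sequentially \<or> filterlim k (at_left 0) sequentially"
    and k_nz: "\<And>n. k n \<noteq> 0"
  shows "(\<lambda>n. (integral {A..B} (\<lambda>x. U (x + (y + k n)) (y + k n)) - integral {A..B} (\<lambda>x. U (x + y) y)) / k n)
           \<longlonglongrightarrow> 0"
proof -
  have k_lim: "k \<longlonglongrightarrow> 0"
    using k0 by (auto simp: filterlim_at)
  have sq: "\<bar>x + y - x1\<bar> < e" "\<bar>x + (y + k n) - x1\<bar> < e" "\<bar>x + y + k n - x1\<bar> < e" if "x \<in> {A..B}" for x n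
    using A[OF that] y k[of n] by linarith+
  have sqt: "\<bar>y - t1\<bar> < e" "\<bar>y + k n - t1\<bar> < e" for n
    using y k[of n] e by linarith+
  define F where "F = {A..B} \<inter> {x. \<not> regular (x + y) y}"
  define f where "f n x = (U (x + y) (y + k n) - U (x + y) y) / k n" for n x
  define g where "g n x = (U (x + y + k n) y - U (x + y) y) / k n" for n x
  define D where "D n x = (U (x + (y + k n)) (y + k n) - U (x + y) y) / k n" for n x
  define C where "C = {x \<in> {x1 - e..x1 + e} \<inter> {x. (x, y) \<in> \<Omega>}. a x y \<noteq> b x y}"
  have C: "countable C"
    unfolding C_def by (rule countable_corners[where f = "\<lambda>x. U x y"]) (use x_right x_left in auto)
  have cont: "continuous_on {A..B} (\<lambda>x. U (x + r) s)"
    if "\<And>x. x \<in> {A..B} \<Longrightarrow> \<bar>x + r - x1\<bar> < e" "\<bar>s - t1\<bar> < e" for r s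
  proof (rule continuous_at_imp_continuous_on, rule ballI)
    fix x assume "x \<in> {A..B}"
    then have "isCont (\<lambda>x. U x s) (x + r)" using dom that by (intro isCont_x) auto
    then show "isCont (\<lambda>x. U (x + r) s) x"
      by (intro isCont_o2[where f = "\<lambda>x. x + r" and g = "\<lambda>x. U x s"]) auto
  qed
  have "(\<lambda>n. \<integral>x. indicator {A..B} x * D n x \<partial>lborel) \<longlonglongrightarrow> 0"
  proof (rule integral_tendsto_0_by_translation[where f = f and g = g and k = k and F = F
        and C = "(\<lambda>x. x - y) ` C" and N = N and M = "2 * N"])
    have "closed {s. \<not> regular (y + s) y}" by (rule closed_singular_section)
    then show "compact F" unfolding F_def by (intro compact_Int_closed) (auto simp: add.commute)
    show F_sub: "F \<subseteq> {A..B}" by (auto simp: F_def)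
    show "k \<longlonglongrightarrow> 0" by (rule k_lim)
    show "countable ((\<lambda>x. x - y) ` C)" using C by simp
    show "continuous_on F (f n)" for n
      unfolding f_def[abs_def] using sq sqt k_nz
      by (intro continuous_on_subset[OF _ F_sub] continuous_intros cont) auto
    show "continuous_on F (g n)" for n
      unfolding g_def[abs_def] add.assoc using sq sqt k_nz
      by (intro continuous_on_subset[OF _ F_sub] continuous_intros cont) auto
    show "continuous_on {A..B} (D n)" for n
      unfolding D_def[abs_def] using sq sqt k_nz
      by (intro continuous_intros cont) auto
    show "\<bar>f n x\<bar> \<le> N" if "x \<in> F" for n x
    proof -
      have "\<bar>U (x + y) (y + k n) - U (x + y) y\<bar> \<le> N * \<bar>(y + k n) - y\<bar>"
        using that sq sqt by (intro lip_t) (auto simp: F_def)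
      then show ?thesis using k_nz[of n] by (simp add: f_def abs_divide pos_divide_le_eq)
    qed
    show "\<bar>g n x\<bar> \<le> N" if "x \<in> F" for n x
    proof -
      have "\<bar>U (x + y + k n) y - U (x + y) y\<bar> \<le> N * \<bar>(x + y + k n) - (x + y)\<bar>"
        using that sq sqt by (intro lip_x) (auto simp: F_def)
      then show ?thesis using k_nz[of n] by (simp add: g_def abs_divide pos_divide_le_eq)
    qed
    show "\<bar>D n x\<bar> \<le> 2 * N" if x: "x \<in> {A..B}" for n x
    proof -
      have "\<bar>U (x + (y + k n)) (y + k n) - U (x + y) y\<bar> \<le> 2 * N * \<bar>k n\<bar>"
      proof (cases "k n \<ge> 0")
        case True
        then show ?thesis
          using lipschitz_along_characteristic[of "x + y" y "k n"] sq[OF x] sqt by (simp add: add.assoc)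
      next
        case False
        then show ?thesis
          using lipschitz_along_characteristic[of "x + (y + k n)" "y + k n" "- k n"] sq[OF x] sqt
          by (simp add: add.assoc abs_minus_commute)
      qed
      then show ?thesis using k_nz[of n] by (simp add: D_def abs_divide pos_divide_le_eq)
    qed
    show "(\<lambda>n. f n x + g n x) \<longlonglongrightarrow> 0" if x: "x \<in> F - (\<lambda>x. x - y) ` C" for x
    proof -
      have xF: "x \<in> {A..B}" and "x + y \<notin> C" using x by (force simp: F_def)+
      then have ab: "a (x + y) y = b (x + y) y"
        using sq(1)[OF xF] sqt dom by (auto simp: C_def)
      have d: "(x + y, y) \<in> \<Omega>" using sq(1)[OF xF] sqt(1) by (rule dom)
      \<comment> \<open>From the right the limits are \<open>- b\<close> and \<open>a\<close>, from
        the left \<open>- a\<close> and \<open>b\<close>; either sum vanishes where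
        \<open>a = b\<close>.\<close>
      from k0 show ?thesis
      proof
        assume k': "filterlim k (at_right 0) sequentially"
        from tendsto_add[OF filterlim_compose[OF t_right[OF d] k'] filterlim_compose[OF x_right[OF d] k']] ab
        show ?thesis by (simp add: f_def g_def add.assoc)
      next
        assume k': "filterlim k (at_left 0) sequentially"
        from tendsto_add[OF filterlim_compose[OF t_left[OF d] k'] filterlim_compose[OF x_left[OF d] k']] ab
        show ?thesis by (simp add: f_def g_def add.assoc)
      qed
    qed
    show "(\<lambda>n. D n x) \<longlonglongrightarrow> 0" if x: "x \<in> {A..B} - F" for x
    proof -
      have "regular (x + y) y" using x by (auto simp: F_def)
      then obtain d where d: "d > 0" "\<And>x' t' k. \<bar>x' - (x + y)\<bar> < d \<and> \<bar>t' - y\<bar> < d \<and>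
          \<bar>x' + k - (x + y)\<bar> < d \<and> \<bar>t' + k - y\<bar> < d \<Longrightarrow> U (x' + k) (t' + k) = U x' t'"
        unfolding regular_def by blast
      have "\<forall>\<^sub>F n in sequentially. \<bar>k n\<bar> < d"
        using order_tendstoD(2)[OF tendsto_rabs[OF k_lim]] d(1) by simp
      then have "\<forall>\<^sub>F n in sequentially. D n x = 0"
        by (rule eventually_mono) (use d(1) d(2)[of "x + y" y] in \<open>auto simp: D_def add.assoc\<close>)
      then show ?thesis by (rule tendsto_eventually)
    qed
    \<comment> \<open>A horizontal step at height \<open>y\<close> comes first, then a vertical one
      at abscissa \<open>x + y + k n\<close>.\<close>
    show "D n x = f n (x + k n) + g n x" if "x \<in> F" "x + k n \<in> F" for n x
      using k_nz[of n] by (simp add: D_def f_def g_def add_divide_distrib[symmetric] ac_simps)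
  qed
  \<comment> \<open>Continuity of \<open>D n\<close> lets the Lebesgue integral, suited to dominated
    convergence, be read as the gauge integral, suited to differentiation.\<close>
  moreover have "(\<integral>x. indicator {A..B} x * D n x \<partial>lborel) =
      (integral {A..B} (\<lambda>x. U (x + (y + k n)) (y + k n)) - integral {A..B} (\<lambda>x. U (x + y) y)) / k n" for n
  proof -
    have c: "continuous_on {A..B} (\<lambda>x. U (x + (y + k n)) (y + k n))" "continuous_on {A..B} (\<lambda>x. U (x + y) y)"
      using sq sqt by (intro cont; simp)+
    then have "continuous_on {A..B} (D n)"
      unfolding D_def[abs_def] using k_nz by (intro continuous_intros) auto
    then have "(\<integral>x. indicator {A..B} x * D n x \<partial>lborel) = integral {A..B} (D n)"
      using set_borel_integral_eq_integral(2)[OF borel_integrable_atLeastAtMost'[of A B "D n"]]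
      by (simp add: set_lebesgue_integral_def)
    also have "\<dots> = integral {A..B} (\<lambda>x. U (x + (y + k n)) (y + k n) - U (x + y) y) / k n"
      unfolding D_def[abs_def] by (rule integral_divide)
    also have "integral {A..B} (\<lambda>x. U (x + (y + k n)) (y + k n) - U (x + y) y) =
        integral {A..B} (\<lambda>x. U (x + (y + k n)) (y + k n)) - integral {A..B} (\<lambda>x. U (x + y) y)"
      by (intro Henstock_Kurzweil_Integration.integral_diff integrable_continuous_real c)
    finally show ?thesis .
  qed
  ultimately show ?thesis by simp
qed

lemma mean_has_derivative_0:
  assumes A: "\<And>x. x \<in> {A..B} \<Longrightarrow> \<bar>x - (x1 - t1)\<bar> \<le> e / 2" and y: "\<bar>y - t1\<bar> < e / 2"
  shows "((\<lambda>y. integral {A..B} (\<lambda>x. U (x + y) y)) has_real_derivative 0) (at y)"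
proof -
  define V where "V y = integral {A..B} (\<lambda>x. U (x + y) y)" for y
  \<comment> \<open>\<open>\<eta>\<close> is the room left around \<open>y\<close>; steps below it
    keep every term of a sequence admissible.\<close>
  define \<eta> where "\<eta> = e / 2 - \<bar>y - t1\<bar>"
  have \<eta>: "\<eta> > 0" using y by (simp add: \<eta>_def)
  have "((\<lambda>h. (V (y + h) - V y) / h) \<longlongrightarrow> 0) (at 0 within I)"
    if I: "I \<subseteq> {- \<eta><..<\<eta>}" "at 0 within I = at_right 0 \<or> at 0 within I = at_left 0" for I
    unfolding tendsto_at_iff_sequentially
  proof (intro allI impI)
    fix k assume k: "\<forall>n. k n \<in> I - {0}" "k \<longlonglongrightarrow> 0"
    have "filterlim k (at 0 within I) sequentially"
      using k by (auto simp: filterlim_at)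
    moreover have "\<bar>y + k n - t1\<bar> < e / 2" for n
    proof -
      have "k n \<in> {- \<eta><..<\<eta>}" using k(1) I(1) by blast
      then have "\<bar>k n\<bar> < \<eta>" by (auto simp: abs_less_iff)
      then show ?thesis unfolding \<eta>_def by linarith
    qed
    ultimately have "(\<lambda>n. (V (y + k n) - V y) / k n) \<longlonglongrightarrow> 0"
      unfolding V_def by (intro mean_quotient_tendsto_0 A y) (use I k in auto)
    then show "((\<lambda>h. (V (y + h) - V y) / h) \<circ> k) \<longlonglongrightarrow> 0" by (simp add: o_def)
  qed
  note one_sided = this
  have sub: "{0<..<\<eta>} \<subseteq> {- \<eta><..<\<eta>}" "{- \<eta><..<0} \<subseteq> {- \<eta><..<\<eta>}"
    using \<eta> by (auto simp: subset_iff)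
  have right: "at 0 within {0<..<\<eta>} = at_right 0" and left: "at 0 within {- \<eta><..<0} = at_left 0"
    by (rule at_within_nhd[of _ "{- \<eta><..<\<eta>}"]; use \<eta> in auto)+
  have "((\<lambda>h. (V (y + h) - V y) / h) \<longlongrightarrow> 0) (at_right 0)"
    using one_sided[OF sub(1) disjI1[OF right]] unfolding right .
  moreover have "((\<lambda>h. (V (y + h) - V y) / h) \<longlongrightarrow> 0) (at_left 0)"
    using one_sided[OF sub(2) disjI2[OF left]] unfolding left .
  ultimately have "((\<lambda>h. (V (y + h) - V y) / h) \<longlongrightarrow> 0) (at 0)"
    by (simp add: filterlim_at_split)
  then show ?thesis unfolding V_def by (simp add: DERIV_def)
qed

text \<open>The integrals over every interval from \<open>A\<close> to \<open>w\<close> do not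
  depend on the height, so differentiating in \<open>w\<close> shows that the continuous integrands
  agree. For a singular centre this is the contradiction sought.\<close>

lemma regular_centre: "regular x1 t1"
proof -
  \<comment> \<open>\<open>A\<close> and \<open>B\<close> bound the label \<open>x - t\<close> of
    the characteristics near the centre.\<close>
  define A B where "A = x1 - t1 - e / 2" and "B = x1 - t1 + e / 2"
  have const_U: "U (z + y) y = U (z + y') y'"
    if z: "z \<in> {A..B}" and y: "\<bar>y - t1\<bar> < e / 2" and y': "\<bar>y' - t1\<bar> < e / 2" for z y y'
  proof -
    define \<phi> where "\<phi> x = U (x + y) y - U (x + y') y'" for x
    have cont: "continuous_on {A..B} (\<lambda>x. U (x + s) s)" if "\<bar>s - t1\<bar> < e / 2" for s
    proof (rule continuous_at_imp_continuous_on, rule ballI)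
      fix x assume "x \<in> {A..B}"
      then have "\<bar>x + s - x1\<bar> < e" "\<bar>s - t1\<bar> < e"
        using that e unfolding A_def B_def atLeastAtMost_iff by linarith+
      then have "isCont (\<lambda>x. U x s) (x + s)" using dom by (intro isCont_x) auto
      then show "isCont (\<lambda>x. U (x + s) s) x"
        by (intro isCont_o2[where f = "\<lambda>x. x + s" and g = "\<lambda>x. U x s"]) auto
    qed
    have zero: "integral {A..w} \<phi> = 0" if w: "w \<in> {A..B}" for w
    proof -
      have "integral {A..w} (\<lambda>x. U (x + y) y) = integral {A..w} (\<lambda>x. U (x + y') y')"
      proof (rule DERIV_isconst3[where a = "t1 - e / 2" and b = "t1 + e / 2" and x = y and y = y'
            and f = "\<lambda>y. integral {A..w} (\<lambda>x. U (x + y) y)"])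
        show "((\<lambda>y. integral {A..w} (\<lambda>x. U (x + y) y)) has_real_derivative 0) (at s)"
          if "s \<in> {t1 - e / 2<..<t1 + e / 2}" for s
        proof (rule mean_has_derivative_0)
          show "\<bar>x - (x1 - t1)\<bar> \<le> e / 2" if "x \<in> {A..w}" for x
            using that w unfolding A_def B_def atLeastAtMost_iff by linarith
          show "\<bar>s - t1\<bar> < e / 2"
            using that unfolding greaterThanLessThan_iff by linarith
        qed
        show "t1 - e / 2 < t1 + e / 2" using e by simp
        show "y \<in> {t1 - e / 2<..<t1 + e / 2}" "y' \<in> {t1 - e / 2<..<t1 + e / 2}"
          using y y' unfolding greaterThanLessThan_iff by linarith+
      qed
      moreover have "continuous_on {A..w} (\<lambda>x. U (x + y) y)" "continuous_on {A..w} (\<lambda>x. U (x + y') y')"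
        using cont[OF y] cont[OF y'] w by (auto elim!: continuous_on_subset)
      ultimately show ?thesis
        unfolding \<phi>_def[abs_def]
        by (simp add: Henstock_Kurzweil_Integration.integral_diff integrable_continuous_real)
    qed
    \<comment> \<open>The indefinite integral of \<open>\<phi>\<close> has derivative
      \<open>\<phi> z\<close> at \<open>z\<close>, but it is identically 0.\<close>
    have "((\<lambda>w. integral {A..w} \<phi>) has_vector_derivative \<phi> z) (at z within {A..B})"
      unfolding \<phi>_def[abs_def] by (intro integral_has_vector_derivative continuous_intros cont y y' z)
    moreover have "((\<lambda>w. integral {A..w} \<phi>) has_vector_derivative 0) (at z within {A..B})"
      by (rule has_vector_derivative_transform[OF z zero]) (auto intro: derivative_eq_intros)
    ultimately have "\<phi> z = 0"
      using vector_derivative_unique_within_closed_interval[of A B z "\<lambda>w. integral {A..w} \<phi>"] e z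
      by (simp add: A_def B_def)
    then show ?thesis by (simp add: \<phi>_def)
  qed
  \<comment> \<open>With radius \<open>e / 4\<close> in both coordinates, the label
    \<open>x' - t'\<close> differs from \<open>x1 - t1\<close> by less than
    \<open>e / 2\<close>.\<close>
  have "U (x' + k) (t' + k) = U x' t'"
    if *: "\<bar>x' - x1\<bar> < e / 4 \<and> \<bar>t' - t1\<bar> < e / 4 \<and> \<bar>x' + k - x1\<bar> < e / 4 \<and> \<bar>t' + k - t1\<bar> < e / 4" for x' t' k
  proof -
    have "x' - t' \<in> {A..B}" "\<bar>t' + k - t1\<bar> < e / 2" "\<bar>t' - t1\<bar> < e / 2"
      using * e unfolding A_def B_def atLeastAtMost_iff by linarith+
    then have "U (x' - t' + (t' + k)) (t' + k) = U (x' - t' + t') t'"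
      by (rule const_U)
    then show ?thesis by simp
  qed
  moreover have "(x1, t1) \<in> \<Omega>" using e by (intro dom) auto
  ultimately show ?thesis unfolding regular_def using e by (intro conjI exI[of _ "e / 4"]) auto
qed

end

section \<open>Constancy on whole characteristics of a convex domain\<close>

theorem constant_on_characteristics:
  assumes "convex \<Omega>" "(x, t) \<in> \<Omega>" "(x + k, t + k) \<in> \<Omega>"
  shows "U (x + k) (t + k) = U x t"
proof -
  have reg: "regular x t" if "(x, t) \<in> \<Omega>" for x t
  proof (rule ccontr)
    assume "\<not> regular x t"
    \<comment> \<open>A singular point yields a square with singular centre that meets the
      assumptions of \<open>regular_centre\<close>.\<close>
    show False
      by (rule singular_portion[OF that \<open>\<not> regular x t\<close>]) (rule notE[OF _ regular_centre], assumption+)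
  qed
  have *: "U (x + k) (t + k) = U x t" if k: "k \<ge> 0" and xt: "(x, t) \<in> \<Omega>" "(x + k, t + k) \<in> \<Omega>" for x t k
  proof -
    have "regular (x + s) (t + s)" if s: "0 \<le> s" "s \<le> k" for s
    proof (cases "k = 0")
      case False
      have "(1 - s / k) *\<^sub>R (x, t) + (s / k) *\<^sub>R (x + k, t + k) \<in> \<Omega>"
        using assms(1) xt s k False by (intro convexD) auto
      moreover have "(1 - s / k) *\<^sub>R (x, t) + (s / k) *\<^sub>R (x + k, t + k) = (x + s, t + s)"
        using False by (simp add: field_simps)
      ultimately show ?thesis by (intro reg) simp
    qed (use s xt reg in auto)
    from constant_along_characteristic[OF this k] show ?thesis by simp
  qed
  show ?thesis
    using *[of k x t] *[of "- k" "x + k" "t + k"] assms by (cases "k \<ge> 0") auto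
qed

end

subsection \<open>One-sided slopes and tangent planes\<close>

text \<open>Finite limits of the quotients force \<open>f\<close> to tend to \<open>l\<close> from
  both sides, so this packages the common one-sided limit and both specular derivatives without the
  operator \<open>Lim\<close>.\<close>

definition has_side_slopes :: "(real \<Rightarrow> real) \<Rightarrow> real \<Rightarrow> real \<Rightarrow> real \<Rightarrow> bool" where
  "has_side_slopes f l \<alpha> \<beta> \<longleftrightarrow>
     ((\<lambda>h. (f h - l) / h) \<longlongrightarrow> \<alpha>) (at_right 0) \<and> ((\<lambda>h. (f h - l) / h) \<longlongrightarrow> \<beta>) (at_left 0)"

lemma has_side_slopes_imp_tendsto:
  assumes "has_side_slopes f l \<alpha> \<beta>"
  shows "(f \<longlongrightarrow> l) (at 0)"
  using assms tendsto_difference_quotient_imp_tendsto[of f l]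
  unfolding has_side_slopes_def by (auto simp: filterlim_at_split)

lemma has_side_slopes_unique:
  assumes f: "has_side_slopes f l \<alpha> \<beta>" and g: "has_side_slopes f l' \<alpha>' \<beta>'"
  shows "l = l'" "\<alpha> = \<alpha>'" "\<beta> = \<beta>'"
proof -
  show l: "l = l'"
    using f g by (intro tendsto_unique[of "at (0::real)" f]) (auto intro: has_side_slopes_imp_tendsto)
  show "\<alpha> = \<alpha>'"
    using f g unfolding has_side_slopes_def l
    by (intro tendsto_unique[of "at_right (0::real)" "\<lambda>h. (f h - l') / h"]) auto
  show "\<beta> = \<beta>'"
    using f g unfolding has_side_slopes_def l
    by (intro tendsto_unique[of "at_left (0::real)" "\<lambda>h. (f h - l') / h"]) auto
qed

lemma has_side_slopes_cong:
  assumes "e > 0" "has_side_slopes f l \<alpha> \<beta>" "\<And>h. \<bar>h\<bar> < e \<Longrightarrow> f h = g h"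
  shows "has_side_slopes g l \<alpha> \<beta>"
proof -
  have "\<forall>\<^sub>F h in at 0. (f h - l) / h = (g h - l) / h"
    unfolding eventually_at using assms(1,3) by (auto simp: dist_real_def)
  then have "\<forall>\<^sub>F h in at_right 0. (f h - l) / h = (g h - l) / h"
    "\<forall>\<^sub>F h in at_left 0. (f h - l) / h = (g h - l) / h"
    unfolding eventually_at_split by blast+
  with assms(2) show ?thesis
    unfolding has_side_slopes_def by (auto elim: Lim_transform_eventually)
qed

lemma has_side_slopes_reflect:
  assumes "has_side_slopes f l \<alpha> \<beta>"
  shows "has_side_slopes (\<lambda>h. f (- h)) l (- \<beta>) (- \<alpha>)"
proof -
  have "((\<lambda>h. - ((f (- h) - l) / - h)) \<longlongrightarrow> - \<beta>) (at_right 0)"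
    using assms unfolding has_side_slopes_def
    by (intro tendsto_minus) (simp add: filterlim_at_left_to_right)
  moreover have "((\<lambda>h. - ((f (- h) - l) / - h)) \<longlongrightarrow> - \<alpha>) (at_left 0)"
    using assms unfolding has_side_slopes_def
    by (intro tendsto_minus) (simp add: filterlim_at_left_to_right)
  ultimately show ?thesis
    unfolding has_side_slopes_def by simp
qed

lemma has_side_slopes_imp_sdifferentiable:
  assumes "has_side_slopes (\<lambda>h. f (a + h *\<^sub>R v)) l \<alpha> \<beta>"
  shows "sdifferentiable_along f a v" "right_lim f a v = l" "left_lim f a v = l" "mid_lim f a v = l"
    "right_sderiv f a v = \<alpha>" "left_sderiv f a v = \<beta>"
proof -
  note lim = has_side_slopes_imp_tendsto[OF assms, unfolded filterlim_at_split]
  note slopes = assms[unfolded has_side_slopes_def]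
  show r: "right_lim f a v = l"
    unfolding right_lim_def using lim by (intro tendsto_Lim) auto
  show l: "left_lim f a v = l"
    unfolding left_lim_def using lim by (intro tendsto_Lim) auto
  show "mid_lim f a v = l"
    unfolding mid_lim_def r l by simp
  show "right_sderiv f a v = \<alpha>"
    unfolding right_sderiv_def r using slopes by (intro tendsto_Lim) auto
  show "left_sderiv f a v = \<beta>"
    unfolding left_sderiv_def l using slopes by (intro tendsto_Lim) auto
  show "sdifferentiable_along f a v"
    unfolding sdifferentiable_along_def r l using lim slopes by blast
qed

lemma sdifferentiable_imp_has_side_slopes:
  assumes "sdifferentiable_along f a v"
  shows "has_side_slopes (\<lambda>h. f (a + h *\<^sub>R v)) (mid_lim f a v) (right_sderiv f a v) (left_sderiv f a v)"
proof -
  have eq: "right_lim f a v = left_lim f a v" "mid_lim f a v = left_lim f a v"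
    using assms by (auto simp: sdifferentiable_along_def mid_lim_def)
  obtain \<alpha> \<beta> where "has_side_slopes (\<lambda>h. f (a + h *\<^sub>R v)) (left_lim f a v) \<alpha> \<beta>"
    using assms unfolding sdifferentiable_along_def has_side_slopes_def eq by blast
  then show ?thesis
    using has_side_slopes_imp_sdifferentiable[of f a v] eq by metis
qed

text \<open>
  Each value of g is a limit of f at a point other than 0, so the bounds on the difference
  quotients of f near 0 pass to those of g.
\<close>

lemma tendsto_quotient_of_limit_function:
  fixes f g :: "real \<Rightarrow> real"
  assumes q: "((\<lambda>h. (f h - l) / h) \<longlongrightarrow> \<alpha>) (at 0 within S)" and S: "open S" and e: "e > 0"
    and g: "\<And>h. 0 < \<bar>h\<bar> \<Longrightarrow> \<bar>h\<bar> < e \<Longrightarrow> (f \<longlongrightarrow> g h) (at h)"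
  shows "((\<lambda>h. (g h - l) / h) \<longlongrightarrow> \<alpha>) (at 0 within S)"
proof (rule tendstoI)
  fix \<epsilon> :: real assume "\<epsilon> > 0"
  then have "\<forall>\<^sub>F h in at 0 within S. dist ((f h - l) / h) \<alpha> < \<epsilon> / 2"
    by (intro tendstoD[OF q]) simp
  then obtain d where d: "d > 0" "\<And>k. k \<in> S \<Longrightarrow> k \<noteq> 0 \<Longrightarrow> \<bar>k\<bar> < d \<Longrightarrow> dist ((f k - l) / k) \<alpha> < \<epsilon> / 2"
    unfolding eventually_at by (auto simp: dist_real_def)
  have "dist ((g h - l) / h) \<alpha> < \<epsilon>" if h: "h \<in> S" "h \<noteq> 0" "\<bar>h\<bar> < min d e" for h
  proof -
    have "((\<lambda>k. dist ((f k - l) / k) \<alpha>) \<longlongrightarrow> dist ((g h - l) / h) \<alpha>) (at h)"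
      using h by (intro tendsto_intros g) auto
    moreover have "\<forall>\<^sub>F k in at h. dist ((f k - l) / k) \<alpha> \<le> \<epsilon> / 2"
    proof -
      have "open (S \<inter> {- d<..<d} - {0})" using S by (intro open_Diff open_Int) auto
      then have "\<forall>\<^sub>F k in at h. k \<in> S \<inter> {- d<..<d} - {0}"
        by (rule eventually_at_in_open') (use h in auto)
      then show ?thesis
      proof (rule eventually_mono)
        fix k assume "k \<in> S \<inter> {- d<..<d} - {0}"
        then show "dist ((f k - l) / k) \<alpha> \<le> \<epsilon> / 2" using d(2)[of k] by (auto simp: abs_less_iff intro: less_imp_le)
      qed
    qed
    ultimately have "dist ((g h - l) / h) \<alpha> \<le> \<epsilon> / 2"
      by (rule tendsto_upperbound) simp
    then show ?thesis using \<open>\<epsilon> > 0\<close> by simp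
  qed
  then show "\<forall>\<^sub>F h in at 0 within S. dist ((g h - l) / h) \<alpha> < \<epsilon>"
    unfolding eventually_at using d(1) e by (intro exI[of _ "min d e"]) (auto simp: dist_real_def)
qed

text \<open>At each nearby point \<open>mid_lim f\<close> is a genuine limit of \<open>f\<close>, so
  passing to these limits repairs removable discontinuities without changing the slopes at
  \<open>a\<close>.\<close>

lemma has_side_slopes_mid_lim:
  assumes "e > 0" and sdiff: "\<And>h. \<bar>h\<bar> < e \<Longrightarrow> sdifferentiable_along f (a + h *\<^sub>R v) v"
  shows "has_side_slopes (\<lambda>h. mid_lim f (a + h *\<^sub>R v) v) (mid_lim f a v) (right_sderiv f a v) (left_sderiv f a v)"
proof -
  have lim: "((\<lambda>k. f (a + k *\<^sub>R v)) \<longlongrightarrow> mid_lim f (a + h *\<^sub>R v) v) (at h)" if "\<bar>h\<bar> < e" for h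
    using has_side_slopes_imp_tendsto[OF sdifferentiable_imp_has_side_slopes[OF sdiff[OF that]]]
    by (subst LIM_offset_zero_iff) (auto simp: algebra_simps)
  have "has_side_slopes (\<lambda>h. f (a + h *\<^sub>R v)) (mid_lim f a v) (right_sderiv f a v) (left_sderiv f a v)"
    using sdifferentiable_imp_has_side_slopes sdiff[of 0] \<open>e > 0\<close> by simp
  then show ?thesis
    unfolding has_side_slopes_def
    using tendsto_quotient_of_limit_function[OF _ open_greaterThan \<open>e > 0\<close> lim]
      tendsto_quotient_of_limit_function[OF _ open_lessThan \<open>e > 0\<close> lim] by blast
qed

section \<open>Chords of the unit circle and coplanarity\<close>

text \<open>This is \<open>cos (arctan \<alpha>)\<close>, the abscissa at which the ray of slope
  \<open>\<alpha>\<close> from the centre into the right half-plane meets the unit circle.\<close>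

definition ucos :: "real \<Rightarrow> real" where
  "ucos \<alpha> = 1 / sqrt (1 + \<alpha>\<^sup>2)"

lemma ucos_pos: "ucos \<alpha> > 0"
  by (simp add: ucos_def add_pos_nonneg)

lemma ucos_minus: "ucos (- \<alpha>) = ucos \<alpha>"
  by (simp add: ucos_def)

lemma ucos_circle: "(ucos \<alpha>)\<^sup>2 + (\<alpha> * ucos \<alpha>)\<^sup>2 = 1"
proof -
  have "1 + \<alpha>\<^sup>2 > 0" by (simp add: add_pos_nonneg)
  then show ?thesis by (simp add: ucos_def power_divide power_mult_distrib field_simps)
qed

lemma ucos_unique:
  assumes "h > 0" "h\<^sup>2 + (\<alpha> * h)\<^sup>2 = 1"
  shows "h = ucos \<alpha>"
proof -
  have "h\<^sup>2 * (1 + \<alpha>\<^sup>2) = (ucos \<alpha>)\<^sup>2 * (1 + \<alpha>\<^sup>2)"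
    using assms(2) ucos_circle[of \<alpha>] by (simp add: algebra_simps)
  moreover have "1 + \<alpha>\<^sup>2 \<noteq> 0" by (metis add_pos_nonneg less_irrefl zero_le_power2 zero_less_one)
  ultimately have "h\<^sup>2 = (ucos \<alpha>)\<^sup>2" by simp
  then show ?thesis using assms(1) ucos_pos[of \<alpha>] by (simp add: power2_eq_iff)
qed

text \<open>For \<open>\<alpha> = tan A\<close> and \<open>\<beta> = tan B\<close> with angles in
  the open interval from -pi/2 to pi/2, this is \<open>tan ((A + B) / 2)\<close>.\<close>

definition mean_slope :: "real \<Rightarrow> real \<Rightarrow> real" where
  "mean_slope \<alpha> \<beta> = (if \<alpha> + \<beta> \<noteq> 0 then (\<alpha> * \<beta> - 1 + sqrt ((\<alpha>\<^sup>2 + 1) * (\<beta>\<^sup>2 + 1))) / (\<alpha> + \<beta>) else 0)"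

lemma sderiv_along_eq_mean_slope:
  "sderiv_along f a v = mean_slope (right_sderiv f a v) (left_sderiv f a v)"
  by (simp add: sderiv_along_def mean_slope_def Let_def)

lemma mean_slope_minus: "mean_slope (- \<beta>) (- \<alpha>) = - mean_slope \<alpha> \<beta>"
proof (cases "\<alpha> + \<beta> = 0")
  case False
  have "- \<beta> + - \<alpha> = - (\<alpha> + \<beta>)" by simp
  with False show ?thesis
    unfolding mean_slope_def by (simp only: minus_divide_right[symmetric]) (simp add: mult.commute)
qed (simp add: mean_slope_def add.commute)

text \<open>
  The specular derivative is the slope of the line through the two points in which the
  right and left half-tangents meet the unit circle.
\<close>

lemma mean_slope_chord:
  "mean_slope \<alpha> \<beta> * (ucos \<alpha> + ucos \<beta>) = \<alpha> * ucos \<alpha> + \<beta> * ucos \<beta>"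
proof -
  define A B where "A = sqrt (1 + \<alpha>\<^sup>2)" and "B = sqrt (1 + \<beta>\<^sup>2)"
  have AB: "A > 0" "B > 0" by (simp_all add: A_def B_def add_pos_nonneg)
  have sq: "A\<^sup>2 = 1 + \<alpha>\<^sup>2" "B\<^sup>2 = 1 + \<beta>\<^sup>2" by (simp_all add: A_def B_def)
  have AB_eq: "sqrt ((\<alpha>\<^sup>2 + 1) * (\<beta>\<^sup>2 + 1)) = A * B"
    by (simp add: A_def B_def real_sqrt_mult add.commute)
  have u: "ucos \<alpha> = 1 / A" "ucos \<beta> = 1 / B" by (simp_all add: ucos_def A_def B_def)
  have "mean_slope \<alpha> \<beta> * (A + B) = \<alpha> * B + \<beta> * A"
  proof (cases "\<alpha> + \<beta> = 0")
    case True
    then have "\<beta> = - \<alpha>" by simp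
    then show ?thesis by (simp add: mean_slope_def A_def B_def)
  next
    case False
    have "(\<alpha> * \<beta> - 1 + A * B) * (A + B) = (\<alpha> * B + \<beta> * A) * (\<alpha> + \<beta>)"
      using sq by algebra
    moreover have "mean_slope \<alpha> \<beta> * (\<alpha> + \<beta>) = \<alpha> * \<beta> - 1 + A * B"
      using False by (simp add: mean_slope_def AB_eq)
    ultimately have "(mean_slope \<alpha> \<beta> * (A + B)) * (\<alpha> + \<beta>) = (\<alpha> * B + \<beta> * A) * (\<alpha> + \<beta>)"
      by (metis mult.assoc mult.commute)
    then show ?thesis using False by simp
  qed
  then show ?thesis using AB unfolding u by (simp add: field_simps)
qed

text \<open>
  The four points lie on the lines z = p x + r and z = - p y + r, so reflecting the
  second pair gives two pairs of intersection points of one line with the unit circle.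
\<close>

lemma coplanar_opposite_slopes:
  assumes nz: "n1 \<noteq> 0 \<or> n2 \<noteq> 0 \<or> m \<noteq> (0::real)"
    and eqs: "n1 * ucos \<alpha>1 + m * (\<alpha>1 * ucos \<alpha>1) = q" "- n1 * ucos \<beta>1 - m * (\<beta>1 * ucos \<beta>1) = q"
      "n2 * ucos \<alpha>2 + m * (\<alpha>2 * ucos \<alpha>2) = q" "- n2 * ucos \<beta>2 - m * (\<beta>2 * ucos \<beta>2) = q"
    and sum: "mean_slope \<alpha>2 \<beta>2 + mean_slope \<alpha>1 \<beta>1 = 0"
  shows "\<alpha>2 = - \<beta>1" "\<beta>2 = - \<alpha>1"
proof -
  note pos = ucos_pos[of \<alpha>1] ucos_pos[of \<beta>1] ucos_pos[of \<alpha>2] ucos_pos[of \<beta>2]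
  have slope_eq: "s = mean_slope \<alpha> \<beta>"
    if "\<alpha> * ucos \<alpha> = s * ucos \<alpha> + r" "- (\<beta> * ucos \<beta>) = - s * ucos \<beta> + r" for s r \<alpha> \<beta>
  proof -
    have "(s - mean_slope \<alpha> \<beta>) * (ucos \<alpha> + ucos \<beta>) = 0"
      using mean_slope_chord[of \<alpha> \<beta>] that by (simp add: algebra_simps)
    then show ?thesis using ucos_pos[of \<alpha>] ucos_pos[of \<beta>] by simp
  qed
  \<comment> \<open>A vertical plane is excluded: the two points on each axis lie on opposite sides
    of the centre, which would force \<open>n1 = n2 = 0\<close>.\<close>
  have "m \<noteq> 0"
  proof
    assume "m = 0"
    then have *: "n1 * (ucos \<alpha>1 + ucos \<beta>1) = 0" "n2 * (ucos \<alpha>2 + ucos \<beta>2) = 0"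
      using eqs by (simp_all add: algebra_simps)
    then have "n1 = 0" "n2 = 0" using pos by auto
    then show False using nz \<open>m = 0\<close> by simp
  qed
  \<comment> \<open>Solved for the height, the plane has slopes \<open>p\<close> and
    \<open>p'\<close> along the axes and height \<open>r\<close> above the centre.\<close>
  define p p' r where "p = - n1 / m" and "p' = - n2 / m" and "r = q / m"
  have 1: "\<alpha>1 * ucos \<alpha>1 = p * ucos \<alpha>1 + r" "- (\<beta>1 * ucos \<beta>1) = - p * ucos \<beta>1 + r"
    using eqs(1,2) \<open>m \<noteq> 0\<close> by (simp_all add: p_def r_def field_simps)
  have 2: "\<alpha>2 * ucos \<alpha>2 = p' * ucos \<alpha>2 + r" "- (\<beta>2 * ucos \<beta>2) = - p' * ucos \<beta>2 + r"
    using eqs(3,4) \<open>m \<noteq> 0\<close> by (simp_all add: p'_def r_def field_simps)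
  have p': "p' = - p"
    using slope_eq[OF 1] slope_eq[OF 2] sum by simp
  \<comment> \<open>\<open>F x = 1\<close> says that the point of the line of slope \<open>p\<close>
    and height \<open>r\<close> at abscissa \<open>x\<close> lies on the unit circle.\<close>
  define F where "F x = x\<^sup>2 + (p * x + r)\<^sup>2" for x
  have "p * ucos \<alpha>1 + r = \<alpha>1 * ucos \<alpha>1" "p * - ucos \<beta>1 + r = - (\<beta>1 * ucos \<beta>1)"
    "p * - ucos \<alpha>2 + r = \<alpha>2 * ucos \<alpha>2" "p * ucos \<beta>2 + r = - (\<beta>2 * ucos \<beta>2)"
    using 1 2 p' by auto
  then have F: "F (ucos \<alpha>1) = 1" "F (- ucos \<beta>1) = 1" "F (- ucos \<alpha>2) = 1" "F (ucos \<beta>2) = 1"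
    unfolding F_def by (simp_all only: power2_minus ucos_circle)
  have F_diff: "(1 + p\<^sup>2) * (x + y) + 2 * p * r = 0" if "F x = 1" "F y = 1" "x \<noteq> y" for x y
  proof -
    have "(x - y) * ((1 + p\<^sup>2) * (x + y) + 2 * p * r) = F x - F y"
      by (simp add: F_def power2_eq_square algebra_simps)
    then show ?thesis using that by simp
  qed
  have pp: "1 + p\<^sup>2 \<noteq> 0" by (metis add_pos_nonneg less_irrefl zero_le_power2 zero_less_one)
  have root: "x = y" if "F x = 1" "F y = 1" "F z = 1" "z \<noteq> x" "z \<noteq> y" for x y z
  proof -
    have "(1 + p\<^sup>2) * (z + x) = (1 + p\<^sup>2) * (z + y)"
      using F_diff[of z x] F_diff[of z y] that by linarith
    then show ?thesis using pp by simp
  qed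
  \<comment> \<open>A quadratic has at most two roots, and a root of the other sign is present, so
    the two positive roots coincide; likewise the two negative ones below.\<close>
  have "ucos \<alpha>1 = ucos \<beta>2" by (rule root[OF F(1) F(4) F(2)]) (use pos in linarith)+
  then have "(\<alpha>1 + \<beta>2) * ucos \<alpha>1 = 0" using 1 2 p' by (simp add: distrib_right)
  then show "\<beta>2 = - \<alpha>1" using pos by auto
  have "- ucos \<beta>1 = - ucos \<alpha>2" by (rule root[OF F(2) F(3) F(1)]) (use pos in linarith)+
  then have "(\<alpha>2 + \<beta>1) * ucos \<beta>1 = 0" using 1 2 p' by (simp add: distrib_right)
  then show "\<alpha>2 = - \<beta>1" using pos by auto
qed

section \<open>Intersection points and strong tangent planes\<close>

lemma phototangent_sphere:
  fixes u :: "real^2 \<Rightarrow> real" and i :: 2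
  assumes "has_side_slopes (\<lambda>h. u (a + h *\<^sub>R axis i 1)) l \<alpha> \<beta>"
  shows "phototangent u a i \<inter> sphere (a, mid_lim u a (axis i 1)) 1 =
    {(a + ucos \<alpha> *\<^sub>R axis i 1, l + \<alpha> * ucos \<alpha>), (a + (- ucos \<beta>) *\<^sub>R axis i 1, l + - \<beta> * ucos \<beta>)}"
proof -
  note eq = has_side_slopes_imp_sdifferentiable(3-6)[OF assms] has_side_slopes_imp_sdifferentiable(2)[OF assms]
  define z where "z h = (if h < 0 then \<beta> * h + l else if h = 0 then l else \<alpha> * h + l)" for h
  have pt: "phototangent u a i = range (\<lambda>h. (a + h *\<^sub>R axis i 1, z h))"
    unfolding phototangent_def eq z_def ..
  have sphere_iff: "(a + h *\<^sub>R axis i 1, z h) \<in> sphere (a, l) 1 \<longleftrightarrow> h\<^sup>2 + (z h - l)\<^sup>2 = 1" for h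
    unfolding mem_sphere dist_Pair_Pair by (simp add: dist_norm power2_commute)
  have "h\<^sup>2 + (z h - l)\<^sup>2 = 1 \<longleftrightarrow> h = ucos \<alpha> \<or> h = - ucos \<beta>" for h
  proof
    assume *: "h\<^sup>2 + (z h - l)\<^sup>2 = 1"
    consider "h > 0" | "h < 0" | "h = 0" by linarith
    then show "h = ucos \<alpha> \<or> h = - ucos \<beta>"
    proof cases
      case 1
      then show ?thesis using * ucos_unique[of h \<alpha>] by (simp add: z_def)
    next
      case 2
      then show ?thesis using * ucos_unique[of "- h" \<beta>] by (simp add: z_def)
    next
      case 3
      then show ?thesis using * by (simp add: z_def)
    qed
  next
    assume "h = ucos \<alpha> \<or> h = - ucos \<beta>"
    then show "h\<^sup>2 + (z h - l)\<^sup>2 = 1"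
      using ucos_pos[of \<alpha>] ucos_pos[of \<beta>] ucos_circle[of \<alpha>] ucos_circle[of \<beta>]
      by (elim disjE) (simp_all add: z_def)
  qed
  then have "phototangent u a i \<inter> sphere (a, l) 1 = (\<lambda>h. (a + h *\<^sub>R axis i 1, z h)) ` {ucos \<alpha>, - ucos \<beta>}"
    unfolding pt using sphere_iff by blast
  also have "\<dots> = {(a + ucos \<alpha> *\<^sub>R axis i 1, l + \<alpha> * ucos \<alpha>), (a + (- ucos \<beta>) *\<^sub>R axis i 1, l + - \<beta> * ucos \<beta>)}"
    using ucos_pos[of \<alpha>] ucos_pos[of \<beta>] by (simp add: z_def add.commute)
  finally show ?thesis unfolding eq .
qed

lemma photo_points_eq:
  assumes "has_side_slopes (\<lambda>h. u (a + h *\<^sub>R axis 1 1)) l \<alpha>1 \<beta>1"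
    and "has_side_slopes (\<lambda>h. u (a + h *\<^sub>R axis 2 1)) l \<alpha>2 \<beta>2"
  shows "photo_points u a =
    {(a + ucos \<alpha>1 *\<^sub>R axis 1 1, l + \<alpha>1 * ucos \<alpha>1), (a + (- ucos \<beta>1) *\<^sub>R axis 1 1, l + - \<beta>1 * ucos \<beta>1),
     (a + ucos \<alpha>2 *\<^sub>R axis 2 1, l + \<alpha>2 * ucos \<alpha>2), (a + (- ucos \<beta>2) *\<^sub>R axis 2 1, l + - \<beta>2 * ucos \<beta>2)}"
proof -
  have "sdifferentiable_partial u a i" for i :: 2
    using has_side_slopes_imp_sdifferentiable(1)[OF assms(1)] has_side_slopes_imp_sdifferentiable(1)[OF assms(2)]
    using exhaust_2[of i] by auto
  then have "{i. sdifferentiable_partial u a i} = {1, 2}"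
    using UNIV_2 by auto
  then have "photo_points u a = (phototangent u a 1 \<inter> sphere (a, mid_lim u a (axis 1 1)) 1) \<union>
      (phototangent u a 2 \<inter> sphere (a, mid_lim u a (axis 2 1)) 1)"
    by (simp add: photo_points_def)
  then show ?thesis
    unfolding phototangent_sphere[OF assms(1)] phototangent_sphere[OF assms(2)] by auto
qed

text \<open>Each phototangent meets its sphere in at most two points, so four points require both
  directions.\<close>

lemma sdifferentiable_at_imp_partial:
  assumes "sdifferentiable_at u a"
  shows "sdifferentiable_partial u a i"
proof (rule ccontr)
  assume i: "\<not> sdifferentiable_partial u a i"
  have two: "finite (phototangent u a j \<inter> sphere (a, mid_lim u a (axis j 1)) 1) \<and>
      card (phototangent u a j \<inter> sphere (a, mid_lim u a (axis j 1)) 1) \<le> 2"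
    if "sdifferentiable_partial u a j" for j
    unfolding phototangent_sphere[OF sdifferentiable_imp_has_side_slopes[OF that]]
    by (auto simp: card_insert_if)
  obtain j where "{i. sdifferentiable_partial u a i} \<subseteq> {j}"
    using i exhaust_2 by (metis (mono_tags, lifting) insertCI mem_Collect_eq subsetI)
  then consider "{i. sdifferentiable_partial u a i} = {}" | "{i. sdifferentiable_partial u a i} = {j}"
    by blast
  then have "card (photo_points u a) \<le> 2"
  proof cases
    case 1
    then show ?thesis by (simp add: photo_points_def)
  next
    case 2
    then show ?thesis using two[of j] by (auto simp: photo_points_def)
  qed
  then show False using assms by (simp add: sdifferentiable_at_def)
qed

lemma inner_plane_axis:
  fixes w a :: "real^2" and m l c z :: real
  shows "(w, m) \<bullet> (a + c *\<^sub>R axis i 1, l + z) = (w, m) \<bullet> (a, l) + (w $ i * c + m * z)"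
  by (simp add: inner_prod_def inner_add_right inner_axis algebra_simps)

lemma specular_value_eq:
  assumes "mid_lim u a (axis 1 1) = mid_lim u a (axis 2 1)"
  shows "specular_value u a = mid_lim u a (axis i 1)"
  unfolding specular_value_def
proof (rule the_equality)
  show "\<forall>j. mid_lim u a (axis j 1) = mid_lim u a (axis i 1)"
    using assms exhaust_2[of i] by (auto simp: forall_2)
qed auto

lemma hyperplane_opposite_slopes:
  assumes S: "strong_specular_tangent_hyperplane u a S"
    and sum: "spartial 2 u a + spartial 1 u a = 0"
  shows "right_sderiv u a (axis 2 1) = - left_sderiv u a (axis 1 1)"
    and "left_sderiv u a (axis 2 1) = - right_sderiv u a (axis 1 1)"
proof -
  define \<alpha> \<beta> where "\<alpha> i = right_sderiv u a (axis i 1)" and "\<beta> i = left_sderiv u a (axis i 1)" for i :: 2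
  define l where "l = mid_lim u a (axis 1 1)"
  have at: "sdifferentiable_at u a" and aff: "affine S" "aff_dim S = 2" "photo_points u a \<subseteq> S"
    using S by (auto simp: strong_specular_tangent_hyperplane_def)
  have l: "mid_lim u a (axis i 1) = l" for i
    using at exhaust_2[of i] by (auto simp: sdifferentiable_at_def l_def)
  have slopes: "has_side_slopes (\<lambda>h. u (a + h *\<^sub>R axis i 1)) l (\<alpha> i) (\<beta> i)" for i
    using sdifferentiable_imp_has_side_slopes[OF sdifferentiable_at_imp_partial[OF at], of i]
    unfolding \<alpha>_def \<beta>_def l .
  \<comment> \<open>A plane in three-space is given by one equation; \<open>w\<close> and
    \<open>m\<close> are the horizontal and vertical parts of its normal.\<close>
  have "aff_dim S = int (DIM((real^2) \<times> real) - 1)" using aff(2) by simp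
  from this[unfolded aff_dim_eq_hyperplane]
  obtain n q where "n \<noteq> 0" and n: "affine hull S = {x. n \<bullet> x = q}"
    by (elim exE conjE)
  obtain w m where wm: "n = (w, m)" by (cases n)
  have "w $ 1 \<noteq> 0 \<or> w $ 2 \<noteq> 0 \<or> m \<noteq> 0"
  proof (rule ccontr)
    assume "\<not> ?thesis"
    then have "w = 0" "m = 0" by (simp_all add: vec_eq_iff forall_2)
    then show False using \<open>n \<noteq> 0\<close> wm by (simp add: zero_prod_def)
  qed
  moreover have on_plane: "w $ i * c + m * z = q - (w, m) \<bullet> (a, l)"
    if "(a + c *\<^sub>R axis i 1, l + z) \<in> photo_points u a" for i c z
  proof -
    have "(a + c *\<^sub>R axis i 1, l + z) \<in> affine hull S"
      by (rule subsetD[OF hull_subset subsetD[OF aff(3) that]])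
    then show ?thesis unfolding n wm mem_Collect_eq inner_plane_axis by (simp only: eq_diff_eq add.commute)
  qed
  have "w $ 1 * ucos (\<alpha> 1) + m * (\<alpha> 1 * ucos (\<alpha> 1)) = q - (w, m) \<bullet> (a, l)"
      "w $ 1 * (- ucos (\<beta> 1)) + m * (- \<beta> 1 * ucos (\<beta> 1)) = q - (w, m) \<bullet> (a, l)"
      "w $ 2 * ucos (\<alpha> 2) + m * (\<alpha> 2 * ucos (\<alpha> 2)) = q - (w, m) \<bullet> (a, l)"
      "w $ 2 * (- ucos (\<beta> 2)) + m * (- \<beta> 2 * ucos (\<beta> 2)) = q - (w, m) \<bullet> (a, l)"
    by (rule on_plane, simp only: photo_points_eq[OF slopes slopes] insert_iff simp_thms)+
  moreover have "mean_slope (\<alpha> 2) (\<beta> 2) + mean_slope (\<alpha> 1) (\<beta> 1) = 0"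
    using sum unfolding sderiv_along_eq_mean_slope \<alpha>_def \<beta>_def .
  ultimately have "\<alpha> 2 = - \<beta> 1 \<and> \<beta> 2 = - \<alpha> 1"
    using coplanar_opposite_slopes[of "w $ 1" "w $ 2" m "\<alpha> 1" _ "\<beta> 1" "\<alpha> 2" "\<beta> 2"] by simp
  then show "right_sderiv u a (axis 2 1) = - left_sderiv u a (axis 1 1)"
    "left_sderiv u a (axis 2 1) = - right_sderiv u a (axis 1 1)"
    by (auto simp: \<alpha>_def \<beta>_def)
qed

text \<open>With mirrored slopes the two chords have slopes \<open>p\<close> and \<open>- p\<close>
  and pass at the same height \<open>r\<close> over the centre, so they span a plane.\<close>

lemma ex_strong_hyperplane:
  assumes "has_side_slopes (\<lambda>h. u (a + h *\<^sub>R axis 1 1)) l \<alpha> \<beta>"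
    and "has_side_slopes (\<lambda>h. u (a + h *\<^sub>R axis 2 1)) l (- \<beta>) (- \<alpha>)"
  shows "\<exists>S. strong_specular_tangent_hyperplane u a S"
proof -
  define p where "p = mean_slope \<alpha> \<beta>"
  define w :: "real^2" where "w = (\<chi> i. if i = 1 then p else - p)"
  define r where "r = \<alpha> * ucos \<alpha> - p * ucos \<alpha>"
  define S where "S = {x. (w, -1 :: real) \<bullet> x = (w, -1) \<bullet> (a, l) - r}"
  have r: "r = p * ucos \<beta> - \<beta> * ucos \<beta>"
    using mean_slope_chord[of \<alpha> \<beta>] by (simp add: r_def p_def algebra_simps)
  note pts = photo_points_eq[OF assms, unfolded ucos_minus]
  have "(w, -1) \<noteq> (0 :: (real^2) \<times> real)" by (simp add: zero_prod_def)
  then have "affine S" "aff_dim S = 2"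
    unfolding S_def by (simp_all add: affine_hyperplane aff_dim_hyperplane)
  moreover have "photo_points u a \<subseteq> S"
  proof -
    have "w $ 1 * ucos \<alpha> + -1 * (\<alpha> * ucos \<alpha>) = - r" "w $ 1 * (- ucos \<beta>) + -1 * (- \<beta> * ucos \<beta>) = - r"
      "w $ 2 * ucos \<beta> + -1 * (- \<beta> * ucos \<beta>) = - r" "w $ 2 * (- ucos \<alpha>) + -1 * (- (- \<alpha>) * ucos \<alpha>) = - r"
      using r by (simp_all add: w_def r_def)
    then show ?thesis
      unfolding pts S_def insert_subset mem_Collect_eq inner_plane_axis by simp
  qed
  moreover have "card (photo_points u a) = 4"
  proof -
    define P where "P i c z = (a + c *\<^sub>R axis i 1, l + z)" for i :: 2 and c z
    have P: "P i c z \<noteq> P j d y" if "c \<noteq> 0" "i \<noteq> j \<or> c \<noteq> d" for i j c d y z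
    proof
      assume "P i c z = P j d y"
      then have "(c *\<^sub>R axis i 1 :: real^2) $ i = (d *\<^sub>R axis j 1 :: real^2) $ i"
        by (simp add: P_def)
      then show False using that by (auto simp: axis_def split: if_splits)
    qed
    \<comment> \<open>The four points already differ in their base points: by the axis, or by the
      sign along it.\<close>
    have "ucos \<alpha> \<noteq> - ucos \<beta>" "ucos \<beta> \<noteq> - ucos \<alpha>" "ucos \<alpha> \<noteq> 0" "ucos \<beta> \<noteq> 0"
      using ucos_pos[of \<alpha>] ucos_pos[of \<beta>] by linarith+
    then show ?thesis
      unfolding pts P_def[symmetric] by (simp add: card_insert_if P)
  qed
  moreover have "mid_lim u a (axis 1 1) = mid_lim u a (axis 2 1)"
    using assms[THEN has_side_slopes_imp_sdifferentiable(4)] by simp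
  ultimately show ?thesis
    unfolding strong_specular_tangent_hyperplane_def sdifferentiable_at_def by blast
qed

(* The values of u at removable discontinuities are invisible to every hypothesis (the
   indicator function of one point satisfies them all), so the identity u(x,t) = h(x - t)
   is stated for the specular values u[(x,t)] of an arbitrary u, and for u itself when
   u(a) = u[a] throughout.  The last conjunct is the arbitrariness of h, with no
   normalization of h or u. *)
theorem theorem4p1:
  shows "(\<forall>u. has_strong_hyperplanes u \<longrightarrow>
            (solves_transport u \<longleftrightarrow>
              (\<exists>h. sdifferentiable_real h \<and>
                (\<forall>a\<in>upper_half_plane. specular_value u a = h (a $ 1 - a $ 2)))))
       \<and> (\<forall>u. has_strong_hyperplanes u \<longrightarrow>
            (\<forall>a\<in>upper_half_plane. u a = specular_value u a) \<longrightarrow>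
            (solves_transport u \<longleftrightarrow>
              (\<exists>h. sdifferentiable_real h \<and>
                (\<forall>a\<in>upper_half_plane. u a = h (a $ 1 - a $ 2)))))
       \<and> (\<forall>h. sdifferentiable_real h \<longrightarrow>
            has_strong_hyperplanes (\<lambda>a. h (a $ 1 - a $ 2)) \<and>
            solves_transport (\<lambda>a. h (a $ 1 - a $ 2)))"
proof -
  define U where "U u x t = specular_value u (vector [x, t])" for u x t
  have vec: "vector [x, t] + h *\<^sub>R axis 1 1 = (vector [x + h, t] :: real^2)"
    "vector [x, t] + h *\<^sub>R axis 2 1 = (vector [x, t + h] :: real^2)" for x t h :: real
    by (simp_all add: vec_eq_iff forall_2 axis_def)
  have vec_eq: "a = vector [a $ 1, a $ 2]" for a :: "real^2"
    by (simp add: vec_eq_iff forall_2)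
  have near: "a + h *\<^sub>R axis i 1 \<in> upper_half_plane"
    if "a \<in> upper_half_plane" "\<bar>h\<bar> < a $ 2" for a h and i :: 2
    using that exhaust_2[of i] by (auto simp: upper_half_plane_def axis_def)
  have val: "specular_value u a = mid_lim u a (axis i 1)" "sdifferentiable_partial u a i"
    if "has_strong_hyperplanes u" "a \<in> upper_half_plane" for u a i
  proof -
    have "sdifferentiable_at u a"
      using that by (auto simp: has_strong_hyperplanes_def strong_specular_tangent_hyperplane_def)
    then show "specular_value u a = mid_lim u a (axis i 1)" "sdifferentiable_partial u a i"
      by (auto simp: sdifferentiable_at_def intro: specular_value_eq sdifferentiable_at_imp_partial)
  qed
  \<comment> \<open>On the half-plane the specular value equals \<open>mid_lim\<close> in either
    direction, so along both axes it inherits the slopes of \<open>u\<close>; \<open>a $ 2\<close>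
    is the distance to the boundary.\<close>
  have slopes: "has_side_slopes (\<lambda>h. specular_value u (a + h *\<^sub>R axis i 1)) (specular_value u a)
      (right_sderiv u a (axis i 1)) (left_sderiv u a (axis i 1))"
    if u: "has_strong_hyperplanes u" and a: "a \<in> upper_half_plane" for u a i
  proof -
    have *: "has_side_slopes (\<lambda>h. mid_lim u (a + h *\<^sub>R axis i 1) (axis i 1)) (specular_value u a)
        (right_sderiv u a (axis i 1)) (left_sderiv u a (axis i 1))"
      unfolding val(1)[OF u a, of i]
      by (rule has_side_slopes_mid_lim[of "a $ 2"])
        (use a near[OF a] val(2)[OF u] in \<open>auto simp: upper_half_plane_def\<close>)
    show ?thesis
      by (rule has_side_slopes_cong[of "a $ 2", OF _ *])
        (use a near[OF a] val(1)[OF u, of _ i] in \<open>auto simp: upper_half_plane_def\<close>)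
  qed
  have solution_imp: "\<exists>h. sdifferentiable_real h \<and>
      (\<forall>a\<in>upper_half_plane. specular_value u a = h (a $ 1 - a $ 2))"
    if u: "has_strong_hyperplanes u" and sol: "solves_transport u" for u
  proof -
    define \<alpha> \<beta> where "\<alpha> x t = right_sderiv u (vector [x, t]) (axis 1 1)"
      and "\<beta> x t = left_sderiv u (vector [x, t]) (axis 1 1)" for x t
    define \<Omega> where "\<Omega> = (UNIV :: real set) \<times> {0 :: real<..}"
    have in_H: "vector [x, t] \<in> upper_half_plane" if "(x, t) \<in> \<Omega>" for x t
      using that by (simp add: \<Omega>_def upper_half_plane_def)
    have U1: "has_side_slopes (\<lambda>h. U u (x + h) t) (U u x t) (\<alpha> x t) (\<beta> x t)" if "(x, t) \<in> \<Omega>" for x t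
      using slopes[OF u in_H[OF that], of 1] unfolding vec U_def \<alpha>_def \<beta>_def .
    have U2: "has_side_slopes (\<lambda>h. U u x (t + h)) (U u x t) (- \<beta> x t) (- \<alpha> x t)" if "(x, t) \<in> \<Omega>" for x t
    proof -
      have H: "vector [x, t] \<in> upper_half_plane" by (rule in_H[OF that])
      obtain S where "strong_specular_tangent_hyperplane u (vector [x, t]) S"
        using u H by (auto simp: has_strong_hyperplanes_def)
      moreover have "spartial 2 u (vector [x, t]) + spartial 1 u (vector [x, t]) = 0"
        using sol H by (auto simp: solves_transport_def)
      ultimately have "right_sderiv u (vector [x, t]) (axis 2 1) = - \<beta> x t"
        "left_sderiv u (vector [x, t]) (axis 2 1) = - \<alpha> x t"
        unfolding \<alpha>_def \<beta>_def by (rule hyperplane_opposite_slopes)+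
      then show ?thesis
        using slopes[OF u H, of 2] unfolding vec U_def by simp
    qed
    interpret transport "U u" \<Omega> \<alpha> \<beta>
    proof
      show "open \<Omega>" unfolding \<Omega>_def by (intro open_Times) auto
    qed (use U1 U2 in \<open>simp_all add: has_side_slopes_def\<close>)
    have "convex \<Omega>"
      unfolding \<Omega>_def by (intro convex_Times) auto
    \<comment> \<open>The profile is read off at height 1, where \<open>x - t = s\<close> means
      \<open>x = s + 1\<close>.\<close>
    define h where "h s = U u (s + 1) 1" for s
    have "sdifferentiable_along h s 1" for s
    proof (rule has_side_slopes_imp_sdifferentiable(1))
      show "has_side_slopes (\<lambda>k. h (s + k *\<^sub>R 1)) (U u (s + 1) 1) (\<alpha> (s + 1) 1) (\<beta> (s + 1) 1)"
        using U1[of "s + 1" 1] by (simp add: h_def \<Omega>_def add.assoc add.commute[of 1])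
    qed
    moreover have "specular_value u a = h (a $ 1 - a $ 2)" if "a \<in> upper_half_plane" for a
    proof -
      have "U u (a $ 1 + (1 - a $ 2)) (a $ 2 + (1 - a $ 2)) = U u (a $ 1) (a $ 2)"
        using that by (intro constant_on_characteristics \<open>convex \<Omega>\<close>) (auto simp: \<Omega>_def upper_half_plane_def)
      then show ?thesis using vec_eq[of a] by (simp add: h_def U_def algebra_simps)
    qed
    ultimately show ?thesis unfolding sdifferentiable_real_def by blast
  qed
  \<comment> \<open>A step \<open>k\<close> along the first axis moves \<open>x - t\<close> by
    \<open>k\<close>, along the second by \<open>- k\<close>; hence the mirrored slopes.\<close>
  have along: "has_side_slopes (\<lambda>k. g ((a + k *\<^sub>R axis 1 1) $ 1 - (a + k *\<^sub>R axis 1 1) $ 2)) l \<alpha> \<beta>"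
    "has_side_slopes (\<lambda>k. g ((a + k *\<^sub>R axis 2 1) $ 1 - (a + k *\<^sub>R axis 2 1) $ 2)) l (- \<beta>) (- \<alpha>)"
    if "has_side_slopes (\<lambda>k. g (a $ 1 - a $ 2 + k)) l \<alpha> \<beta>" for g l \<alpha> \<beta> and a :: "real^2"
  proof -
    have "(a + k *\<^sub>R axis 1 1) $ 1 - (a + k *\<^sub>R axis 1 1) $ 2 = a $ 1 - a $ 2 + k"
      "(a + k *\<^sub>R axis 2 1) $ 1 - (a + k *\<^sub>R axis 2 1) $ 2 = a $ 1 - a $ 2 + - k" for k
      by (simp_all add: axis_def)
    then show "has_side_slopes (\<lambda>k. g ((a + k *\<^sub>R axis 1 1) $ 1 - (a + k *\<^sub>R axis 1 1) $ 2)) l \<alpha> \<beta>"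
      "has_side_slopes (\<lambda>k. g ((a + k *\<^sub>R axis 2 1) $ 1 - (a + k *\<^sub>R axis 2 1) $ 2)) l (- \<beta>) (- \<alpha>)"
      using that has_side_slopes_reflect[OF that] by (simp_all only:)
  qed
  have real_slopes: "has_side_slopes (\<lambda>k. h (s + k)) (mid_lim h s 1) (right_sderiv h s 1) (left_sderiv h s 1)"
    if "sdifferentiable_real h" for h s
    using sdifferentiable_imp_has_side_slopes[of h s 1] that by (simp add: sdifferentiable_real_def)
  have transport_at: "spartial 2 u a + spartial 1 u a = 0"
    if "right_sderiv u a (axis 2 1) = - left_sderiv u a (axis 1 1)"
      "left_sderiv u a (axis 2 1) = - right_sderiv u a (axis 1 1)" for u a
    unfolding sderiv_along_eq_mean_slope that by (simp add: mean_slope_minus)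
  have imp_solution: "solves_transport u"
    if u: "has_strong_hyperplanes u" and h: "sdifferentiable_real h"
      and eq: "\<forall>a\<in>upper_half_plane. specular_value u a = h (a $ 1 - a $ 2)" for u h
    unfolding solves_transport_def
  proof (intro ballI conjI)
    fix a :: "real^2" assume a: "a \<in> upper_half_plane"
    \<comment> \<open>Near \<open>a\<close> the profile coincides with the specular value and so has
      the slopes of \<open>u\<close>. By uniqueness these are the slopes of \<open>h\<close>,
      mirrored in the second direction.\<close>
    have "has_side_slopes (\<lambda>k. h ((a + k *\<^sub>R axis i 1) $ 1 - (a + k *\<^sub>R axis i 1) $ 2)) (specular_value u a)
        (right_sderiv u a (axis i 1)) (left_sderiv u a (axis i 1))" for i
      by (rule has_side_slopes_cong[of "a $ 2", OF _ slopes[OF u a]])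
        (use a near[OF a] eq in \<open>auto simp: upper_half_plane_def\<close>)
    note has_side_slopes_unique[OF this along(1)[OF real_slopes[OF h]]]
      and has_side_slopes_unique[OF this along(2)[OF real_slopes[OF h]]]
    then show "spartial 2 u a + spartial 1 u a = 0"
      by (intro transport_at) simp_all
  qed (use val(2)[OF u] in auto)
  \<comment> \<open>The function uses the values of \<open>h\<close> itself. Its slopes depend only
    on one-sided limits of \<open>h\<close>, so removable discontinuities of \<open>h\<close> do no
    harm.\<close>
  have profile: "has_strong_hyperplanes (\<lambda>a. h (a $ 1 - a $ 2)) \<and> solves_transport (\<lambda>a. h (a $ 1 - a $ 2))"
    if h: "sdifferentiable_real h" for h
  proof -
    define u where "u = (\<lambda>a :: real^2. h (a $ 1 - a $ 2))"
    define l \<alpha> \<beta> where "l a = mid_lim h (a $ 1 - a $ 2) 1"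
      and "\<alpha> a = right_sderiv h (a $ 1 - a $ 2) 1" and "\<beta> a = left_sderiv h (a $ 1 - a $ 2) 1" for a :: "real^2"
    have 1: "has_side_slopes (\<lambda>k. u (a + k *\<^sub>R axis 1 1)) (l a) (\<alpha> a) (\<beta> a)"
      and 2: "has_side_slopes (\<lambda>k. u (a + k *\<^sub>R axis 2 1)) (l a) (- \<beta> a) (- \<alpha> a)" for a
      unfolding u_def l_def \<alpha>_def \<beta>_def by (rule along; rule real_slopes[OF h])+
    have "\<exists>S. strong_specular_tangent_hyperplane u a S" for a
      using 1 2 by (rule ex_strong_hyperplane)
    moreover have "spartial 2 u a + spartial 1 u a = 0" for a
      using has_side_slopes_imp_sdifferentiable(5,6)[OF 1] has_side_slopes_imp_sdifferentiable(5,6)[OF 2]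
      by (intro transport_at) simp_all
    moreover have "sdifferentiable_partial u a 1" "sdifferentiable_partial u a 2" for a
      using has_side_slopes_imp_sdifferentiable(1)[OF 1] has_side_slopes_imp_sdifferentiable(1)[OF 2] .
    ultimately show ?thesis
      unfolding has_strong_hyperplanes_def solves_transport_def u_def[symmetric] by blast
  qed
  have equiv: "solves_transport u \<longleftrightarrow>
      (\<exists>h. sdifferentiable_real h \<and> (\<forall>a\<in>upper_half_plane. specular_value u a = h (a $ 1 - a $ 2)))"
    if "has_strong_hyperplanes u" for u
    using solution_imp[OF that] imp_solution[OF that] by blast
  moreover have "solves_transport u \<longleftrightarrow>
      (\<exists>h. sdifferentiable_real h \<and> (\<forall>a\<in>upper_half_plane. u a = h (a $ 1 - a $ 2)))"
    if "has_strong_hyperplanes u" "\<forall>a\<in>upper_half_plane. u a = specular_value u a" for u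
    using equiv[OF that(1)] that(2) by (simp cong: ball_cong)
  ultimately show ?thesis
    using profile by blast
qed

end
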